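(* Suppose $\mathbf X=[\mathbb R^m]^{|V|}$, $\bar E=E\times\{1,\dots,m\}$ and the subspaces $H_{((i,j),k)}$ are those of a connected undirected graph $G=(V,E)$ as described in the context, and that for every $i\in V_4$ the conjugate $f_i^*$ is strongly convex with modulus $\sigma>0$ (equivalently, $\nabla f_i$ is Lipschitz with constant $1/\sigma$); the sets $V_1,V_2,V_3$ need not be empty. Let $\mathbf z^{n,w}$ and $\mathbf f_{i,n,w}$ be generated by the distributed Dykstra's algorithm, where the primal problem is feasible, $\bar E_n=[\bigcup_{w=1}^{\bar w}S_{n,w}]\cap\bar E$ and $\bigcup_{w=1}^{\bar w}S_{n,w}\supset V$ for all $n\ge1$, and the assumptions (A1)-(A3) of the context hold. Suppose that $F_S$ has a minimizer $\mathbf z^*$ (a dual optimizer) and that the dual iterates $\{\mathbf z_\alpha^{n,w}\}$ are bounded for all $\alpha\in V\cup\bar E$. Let $$h^n=\tilde F_S^{n,0}(\mathbf z^{n,0})-F_S(\mathbf z^* ).$$ Then the values $\{h^n\}_{n=1}^\infty$ converge to zero at the rate of $O(1/n)$.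
   Context: **Problem.** $V,\bar E$ are finite disjoint sets and $\mathbf X=\prod_{i\in V}X_i$ with each $X_i$ a finite dimensional Hilbert space; $[\mathbf x]_i\in X_i$ is the $i$-th component of $\mathbf x\in\mathbf X$. For $i\in V$, $f_i:X_i\to\mathbb R\cup\{\infty\}$ is closed convex and $\mathbf f_i(\mathbf x)=f_i([\mathbf x]_i)$. For $\alpha\in\bar E$, $H_\alpha\subset\mathbf X$ is a linear subspace and $\mathbf f_\alpha=\delta_{H_\alpha}$ (indicator function). Fix $\bar{\mathbf x}\in\mathbf X$. The primal problem is $\min_{\mathbf x\in\mathbf X}\frac12\|\mathbf x-\bar{\mathbf x}\|^2+\sum_{\alpha\in V\cup\bar E}\mathbf f_\alpha(\mathbf x)$. The set $V$ is a disjoint union $V_1\cup V_2\cup V_3\cup V_4$: for $i\in V_1$, $f_i$ is proximable (its proximal subproblems can be solved); for $i\in V_2$, $f_i$ is the indicator function of a closed convex set; for $i\in V_3$, $f_i$ is proximable with $\mathrm{dom}(f_i)=X_i$; for $i\in V_4$, $\mathrm{dom}(f_i)=X_i$ and $f_i$ is accessed through subgradients. $^*$ denotes Fenchel conjugate. **Graph setting.** $G=(V,E)$ is a connected undirected graph, $X_i=\mathbb R^m$ for all $i\in V$, $\bar E=E\times\{1,\dots,m\}$, and $H_{((i,j),k)}=\{\mathbf x\in\mathbf X:[[\mathbf x]_i]_k=[[\mathbf x]_j]_k\}$, where $[[\mathbf x]_i]_k$ is the $k$-th coordinate of $[\mathbf x]_i\in\mathbb R^m$. **Objective functions.** For $\mathbf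 z=\{\mathbf z_\alpha\}_{\alpha\in V\cup\bar E}\in\mathbf X^{|V\cup\bar E|}$, $F_S(\mathbf z)=\sum_{i\in V}\mathbf f_i^*(\mathbf z_i)+\sum_{\alpha\in\bar E}\delta_{H_\alpha}^*(\mathbf z_\alpha)+\frac12\|\bar{\mathbf x}-\sum_{\alpha\in V\cup\bar E}\mathbf z_\alpha\|^2$, and $\tilde F_S^{n,w}(\mathbf z)=\sum_{i\in V}\mathbf f_{i,n,w}^*(\mathbf z_i)+\sum_{\alpha\in\bar E}\delta_{H_\alpha}^*(\mathbf z_\alpha)+\frac12\|\bar{\mathbf x}-\sum_{\alpha\in V\cup\bar E}\mathbf z_\alpha\|^2$, with $\mathbf f_{i,n,w}$ from the algorithm below. **Connecting sets.** $D=\bigcap_{\alpha\in\bar E}H_\alpha$. A subset $E'\subset\bar E$ connects $V$ if $\bigcap_{\alpha\in E'}H_\alpha=D$. $C_{reg}>0$ is a constant such that for all $\mathbf v\in D^\perp$ and all $E'$ connecting $V$ one can write $\mathbf v=\sum_{\alpha\in E'}\mathbf v_\alpha$ with $\mathbf v_\alpha\in H_\alpha^\perp$ and $\|\mathbf v_\alpha\|\le C_{reg}\|\mathbf v\|$ (such a constant exists). **Distributed Dykstra's algorithm.** $\bar w$ is a fixed positive integer. For $\alpha\in(\bar E\cup V)\setminus V_4$ put $\mathbf f_{\alpha,n,w}=\mathbf f_\alpha$ for all $n,w$. Write $\mathbf v_H^{n,w}=\sum_{\alpha\in\bar E}\mathbf z_\alpha^{n,w}$, $\mathbf v_A^{n,w}=\mathbf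 v_H^{n,w}+\sum_{i\in V}\mathbf z_i^{n,w}$, $\mathbf x^{n,w}=\bar{\mathbf x}-\mathbf v_A^{n,w}$. Initialization: choose $\mathbf z_i^{1,0}\in\mathbf X$ with $[\mathbf z_i^{1,0}]_j=0$ for $j\ne i$ ($i\in V$); $\mathbf v_H^{1,0}\in D^\perp$; and for $i\in V_4$ a convex function $f_{i,1,0}:X_i\to\mathbb R$ with $f_{i,1,0}\le f_i$, and $\mathbf f_{i,1,0}(\mathbf x)=f_{i,1,0}([\mathbf x]_i)$. For $n=1,2,\dots$: (a) Choose $\bar E_n\subset\bar E$ that connects $V$, and choose $\{\mathbf z_\alpha^{n,0}\}_{\alpha\in\bar E}$ with $\mathbf z_\alpha^{n,0}=0$ for $\alpha\notin\bar E_n$, $\mathbf z_\alpha^{n,0}\in H_\alpha^\perp$ and $\|\mathbf z_\alpha^{n,0}\|\le C_{reg}\|\mathbf v_H^{n,0}\|$ for all $\alpha\in\bar E$, and $\sum_{\alpha\in\bar E}\mathbf z_\alpha^{n,0}=\mathbf v_H^{n,0}$. (b) For $w=1,\dots,\bar w$: choose a nonempty $S_{n,w}\subset\bar E_n\cup V$. - If $S_{n,w}\subset V_4$: for each $i\in S_{n,w}$ let $q=[\bar{\mathbf x}-\mathbf v_H^{n,w-1}-\mathbf z_i^{n,w-1}]_i$, choose $s\in\partial f_i(q)$, let $\tilde f_{i,n,w-1}(x)=f_i(q)+\langle s,x-q\rangle$, let $x_i^+$ be the minimizer over $x\in X_i$ of $\frac12\|[\bar{\mathbf x}-\mathbf v_H^{n,w-1}]_i-x\|^2+\max\{f_{i,n,w-1},\tilde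 f_{i,n,w-1}\}(x)$, and $z_i^+=[\bar{\mathbf x}-\mathbf v_H^{n,w-1}]_i-x_i^+$ the corresponding dual solution. Set $f_{i,n,w}(x)=\max\{f_{i,n,w-1},\tilde f_{i,n,w-1}\}(x_i^+)+\langle x-x_i^+,z_i^+\rangle$, $\mathbf f_{i,n,w}(\mathbf x)=f_{i,n,w}([\mathbf x]_i)$, $[\mathbf z_i^{n,w}]_i=z_i^+$ and $[\mathbf z_i^{n,w}]_j=0$ for $j\ne i$. For $i\in V_4\setminus S_{n,w}$ set $\mathbf f_{i,n,w}=\mathbf f_{i,n,w-1}$. - Otherwise: set $\mathbf f_{i,n,w}=\mathbf f_{i,n,w-1}$ for all $i\in V_4$, and let $\{\mathbf z_\alpha^{n,w}\}_{\alpha\in S_{n,w}}$ be a minimizer of $\frac12\|\bar{\mathbf x}-\sum_{\alpha\notin S_{n,w}}\mathbf z_\alpha^{n,w-1}-\sum_{\alpha\in S_{n,w}}\mathbf z_\alpha\|^2+\sum_{\alpha\in S_{n,w}}\mathbf f_{\alpha,n,w}^*(\mathbf z_\alpha)$. In both cases $\mathbf z_\alpha^{n,w}=\mathbf z_\alpha^{n,w-1}$ for $\alpha\notin S_{n,w}$. (c) Set $\mathbf z_i^{n+1,0}=\mathbf z_i^{n,\bar w}$ ($i\in V$), $\mathbf v_H^{n+1,0}=\mathbf v_H^{n,\bar w}$, and $\mathbf f_{i,n+1,0}=\mathbf f_{i,n,\bar w}$ ($i\in V_4$). **Assumptions on the algorithm.** Let $p(n,\alpha)=\max\{w'\le\bar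 w:\alpha\in S_{n,w'}\}$. (A1) Whenever $w>1$ and $S_{n,w}\subset V_4$, for each $i\in V_4$ the vector $[\mathbf z_i^{n,w-1}]_i$ is the minimizer over $z\in X_i$ of $\frac12\|[\bar{\mathbf x}-\mathbf v_H^{n,w-1}]_i-z\|^2+f_{i,n,w-1}^*(z)$; in other words, if $w_i$ is the last index $w'\in\{1,\dots,w-1\}$ with $i\in S_{n,w'}$, then for all $\tilde w\in\{w_i+1,\dots,w-1\}$ and $\alpha\in S_{n,\tilde w}\cap\bar E$, $\mathbf v\in H_\alpha^\perp$ implies $[\mathbf v]_i=0$. (A2) For all $i\in V_4$, $\tilde w\in\{p(n,i)+1,\dots,\bar w\}$ and $\alpha\in S_{n,\tilde w}\cap\bar E$, $\mathbf v\in H_\alpha^\perp$ implies $[\mathbf v]_i=0$. (A3) If $V_4\neq\emptyset$, then $S_{n,1}=V_4$ for all $n>1$. *)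

theory Defs
  imports "HOL-Analysis.Analysis" "HOL-Library.Landau_Symbols"
begin

definition fenchel_conj :: "('a::real_inner \<Rightarrow> ereal) \<Rightarrow> 'a \<Rightarrow> ereal" where
  "fenchel_conj g y = (SUP x. ereal (y \<bullet> x) - g x)"

definition conv_indicator :: "'a set \<Rightarrow> 'a \<Rightarrow> ereal" where
  "conv_indicator C x = (if x \<in> C then 0 else \<infinity>)"

text \<open>Closed convex functions with values in the reals extended by plus infinity.
  The constant plus infinity is not excluded; where properness matters it follows from
  feasibility of the primal problem.\<close>

definition closed_convex_fun :: "('a::euclidean_space \<Rightarrow> ereal) \<Rightarrow> bool" where
  "closed_convex_fun g \<longleftrightarrow> (\<forall>x. g x \<noteq> -\<infinity>) \<and>
     closed {(x, r::real). g x \<le> ereal r} \<and> convex {(x, r::real). g x \<le> ereal r}"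

definition subdifferential :: "('a::real_inner \<Rightarrow> ereal) \<Rightarrow> 'a \<Rightarrow> 'a set" where
  "subdifferential g q = {s. \<bar>g q\<bar> \<noteq> \<infinity> \<and> (\<forall>x. g q + ereal (s \<bullet> (x - q)) \<le> g x)}"

definition strongly_convex :: "real \<Rightarrow> ('a::real_inner \<Rightarrow> ereal) \<Rightarrow> bool" where
  "strongly_convex \<sigma> g \<longleftrightarrow> (\<forall>x y. \<forall>t\<in>{0<..<1}.
     g ((1 - t) *\<^sub>R x + t *\<^sub>R y)
       \<le> ereal (1 - t) * g x + ereal t * g y - ereal (\<sigma> / 2 * t * (1 - t) * (norm (x - y))\<^sup>2))"

text \<open>The vertex set is the finite type \<open>'v\<close>, every component space is \<open>real^'m\<close>, and the
  product space is \<open>real^'m^'v\<close>, whose inner product is the sum of those of the components.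
  An edge is a two-element set of vertices. The disjoint union of the vertices and of the pairs
  (edge, coordinate) is formed in a sum type: \<open>Inl\<close> marks vertices, \<open>Inr\<close> marks pairs.\<close>

type_synonym ('v, 'm) idx = "'v + ('v set \<times> 'm)"

definition connected_graph :: "'v set set \<Rightarrow> bool" where
  "connected_graph E \<longleftrightarrow> (\<forall>e\<in>E. card e = 2) \<and> (\<forall>i j. (i, j) \<in> {(a, b). {a, b} \<in> E}\<^sup>*)"

definition Ebar :: "'v set set \<Rightarrow> ('v set \<times> 'm) set" where
  "Ebar E = E \<times> UNIV"

definition Hsub :: "'v set \<times> 'm \<Rightarrow> (real^'m^'v::finite) set" where
  "Hsub = (\<lambda>(e, k). {x. \<forall>i\<in>e. \<forall>j\<in>e. x $ i $ k = x $ j $ k})"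

definition Dsub :: "'v set set \<Rightarrow> (real^'m^'v::finite) set" where
  "Dsub E = (\<Inter>a\<in>Ebar E. Hsub a)"

definition connects :: "'v::finite set set \<Rightarrow> ('v set \<times> 'm::finite) set \<Rightarrow> bool" where
  "connects E E' \<longleftrightarrow> E' \<subseteq> Ebar E \<and> (\<Inter>a\<in>E'. Hsub a :: (real^'m^'v) set) = Dsub E"

definition regularity_constant ::
    "'v::finite set set \<Rightarrow> 'm::finite itself \<Rightarrow> real \<Rightarrow> bool" where
  "regularity_constant E _ C \<longleftrightarrow> C > 0 \<and>
     (\<forall>v \<in> orthogonal_comp (Dsub E :: (real^'m^'v) set). \<forall>E'. connects E E' \<longrightarrow>
        (\<exists>u. v = (\<Sum>a\<in>E'. u a) \<and>
             (\<forall>a\<in>E'. u a \<in> orthogonal_comp (Hsub a) \<and> norm (u a) \<le> C * norm v)))"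

definition lift_fun ::
    "('v \<Rightarrow> real^'m \<Rightarrow> ereal) \<Rightarrow> ('v, 'm) idx \<Rightarrow> real^'m^'v::finite \<Rightarrow> ereal" where
  "lift_fun g \<alpha> x = (case \<alpha> of Inl i \<Rightarrow> g i (x $ i) | Inr a \<Rightarrow> conv_indicator (Hsub a) x)"

definition primal_obj ::
    "'v set set \<Rightarrow> ('v \<Rightarrow> real^'m \<Rightarrow> ereal) \<Rightarrow> real^'m^'v::finite \<Rightarrow> real^'m^'v \<Rightarrow> ereal" where
  "primal_obj E f xbar x =
     ereal (1/2 * (norm (x - xbar))\<^sup>2) + (\<Sum>\<alpha> \<in> UNIV <+> Ebar E. lift_fun f \<alpha> x)"

definition primal_feasible ::
    "'v set set \<Rightarrow> ('v \<Rightarrow> real^'m \<Rightarrow> ereal) \<Rightarrow> real^'m^'v::finite \<Rightarrow> bool" where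
  "primal_feasible E f xbar \<longleftrightarrow> (\<exists>x. primal_obj E f xbar x < \<infinity>)"

definition dual_obj ::
    "'v set set \<Rightarrow> ('v \<Rightarrow> real^'m \<Rightarrow> ereal) \<Rightarrow> real^'m^'v::finite
      \<Rightarrow> (('v, 'm) idx \<Rightarrow> real^'m^'v) \<Rightarrow> ereal" where
  "dual_obj E g xbar z =
     (\<Sum>i\<in>UNIV. fenchel_conj (lift_fun g (Inl i)) (z (Inl i)))
     + (\<Sum>a\<in>Ebar E. fenchel_conj (conv_indicator (Hsub a)) (z (Inr a)))
     + ereal (1/2 * (norm (xbar - (\<Sum>\<alpha> \<in> UNIV <+> Ebar E. z \<alpha>)))\<^sup>2)"

text \<open>The functions in force during the algorithm: the real-valued minorants \<open>m\<close> on \<open>V4\<close>, the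
  original functions elsewhere. Thus \<open>dual_obj E f\<close> is the dual objective, and
  \<open>dual_obj E (cur_fun V4 f (fm n w))\<close> is the one modified at stage \<open>(n, w)\<close>.\<close>

definition cur_fun ::
    "'v set \<Rightarrow> ('v \<Rightarrow> real^'m \<Rightarrow> ereal) \<Rightarrow> ('v \<Rightarrow> real^'m \<Rightarrow> real) \<Rightarrow> 'v \<Rightarrow> real^'m \<Rightarrow> ereal" where
  "cur_fun V4 f m i = (if i \<in> V4 then (\<lambda>x. ereal (m i x)) else f i)"

definition vH :: "'v set set \<Rightarrow> (('v, 'm) idx \<Rightarrow> real^'m^'v::finite) \<Rightarrow> real^'m^'v" where
  "vH E \<zeta> = (\<Sum>a\<in>Ebar E. \<zeta> (Inr a))"

text \<open>One subgradient update of a single vertex: \<open>g\<close> is the vertex function, \<open>m\<close> and \<open>m'\<close> the old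
  and new minorants, \<open>c\<close> the proximal center, \<open>q\<close> the linearization point and \<open>zp\<close> the new dual
  vector.\<close>

definition subgradient_update ::
    "('a::real_inner \<Rightarrow> ereal) \<Rightarrow> ('a \<Rightarrow> real) \<Rightarrow> 'a \<Rightarrow> 'a \<Rightarrow> ('a \<Rightarrow> real) \<Rightarrow> 'a \<Rightarrow> bool" where
  "subgradient_update g m c q m' zp \<longleftrightarrow>
     (\<exists>s xp mx. s \<in> subdifferential g q \<and>
        mx = (\<lambda>x. max (m x) (real_of_ereal (g q) + s \<bullet> (x - q))) \<and>
        is_arg_min (\<lambda>x. 1/2 * (norm (c - x))\<^sup>2 + mx x) (\<lambda>_. True) xp \<and>
        zp = c - xp \<and>
        m' = (\<lambda>x. mx xp + (x - xp) \<bullet> zp))"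

definition subgradient_step ::
    "'v set set \<Rightarrow> ('v \<Rightarrow> real^'m \<Rightarrow> ereal) \<Rightarrow> 'v set \<Rightarrow> real^'m^'v::finite \<Rightarrow> ('v, 'm) idx set
      \<Rightarrow> ('v \<Rightarrow> real^'m \<Rightarrow> real) \<Rightarrow> (('v, 'm) idx \<Rightarrow> real^'m^'v)
      \<Rightarrow> ('v \<Rightarrow> real^'m \<Rightarrow> real) \<Rightarrow> (('v, 'm) idx \<Rightarrow> real^'m^'v) \<Rightarrow> bool" where
  "subgradient_step E f V4 xbar S m \<zeta> m' \<zeta>' \<longleftrightarrow>
     (\<forall>i. Inl i \<in> S \<longrightarrow>
        subgradient_update (f i) (m i) ((xbar - vH E \<zeta>) $ i) ((xbar - vH E \<zeta> - \<zeta> (Inl i)) $ i)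
          (m' i) (\<zeta>' (Inl i) $ i) \<and>
        (\<forall>j. j \<noteq> i \<longrightarrow> \<zeta>' (Inl i) $ j = 0)) \<and>
     (\<forall>i\<in>V4. Inl i \<notin> S \<longrightarrow> m' i = m i)"

text \<open>The minimized expression depends on the candidate \<open>\<xi>\<close> only through its values on \<open>S\<close>.\<close>

definition proximal_step ::
    "'v set set \<Rightarrow> ('v \<Rightarrow> real^'m \<Rightarrow> ereal) \<Rightarrow> 'v set \<Rightarrow> real^'m^'v::finite \<Rightarrow> ('v, 'm) idx set
      \<Rightarrow> ('v \<Rightarrow> real^'m \<Rightarrow> real) \<Rightarrow> (('v, 'm) idx \<Rightarrow> real^'m^'v)
      \<Rightarrow> ('v \<Rightarrow> real^'m \<Rightarrow> real) \<Rightarrow> (('v, 'm) idx \<Rightarrow> real^'m^'v) \<Rightarrow> bool" where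
  "proximal_step E f V4 xbar S m \<zeta> m' \<zeta>' \<longleftrightarrow>
     (\<forall>i\<in>V4. m' i = m i) \<and>
     is_arg_min (\<lambda>\<xi>.
         ereal (1/2 * (norm (xbar - (\<Sum>\<alpha> \<in> (UNIV <+> Ebar E) - S. \<zeta> \<alpha>) - (\<Sum>\<alpha>\<in>S. \<xi> \<alpha>)))\<^sup>2)
         + (\<Sum>\<alpha>\<in>S. fenchel_conj (lift_fun (cur_fun V4 f m') \<alpha>) (\<xi> \<alpha>)))
       (\<lambda>_. True) \<zeta>'"

text \<open>A run consists of \<open>Eb n\<close> (the connecting sets), \<open>S n w\<close> (the active indices),
  \<open>fm n w i\<close> (the minorants, relevant only for \<open>i \<in> V4\<close>) and \<open>z n w\<close> (the dual variables).
  At the start of a cycle the edge components of \<open>z\<close> are chosen afresh; only their sum \<open>vH\<close> is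
  carried over from the end of the previous cycle.\<close>

definition distributed_dykstra ::
    "'v set set \<Rightarrow> ('v \<Rightarrow> real^'m \<Rightarrow> ereal) \<Rightarrow> 'v set \<Rightarrow> real^'m^'v::finite \<Rightarrow> real \<Rightarrow> nat
      \<Rightarrow> (nat \<Rightarrow> ('v set \<times> 'm) set) \<Rightarrow> (nat \<Rightarrow> nat \<Rightarrow> ('v, 'm) idx set)
      \<Rightarrow> (nat \<Rightarrow> nat \<Rightarrow> 'v \<Rightarrow> real^'m \<Rightarrow> real)
      \<Rightarrow> (nat \<Rightarrow> nat \<Rightarrow> ('v, 'm) idx \<Rightarrow> real^'m^'v) \<Rightarrow> bool" where
  "distributed_dykstra E f V4 xbar Creg wbar Eb S fm z \<longleftrightarrow>
     ((\<forall>i j. j \<noteq> i \<longrightarrow> z 1 0 (Inl i) $ j = 0) \<and>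
      vH E (z 1 0) \<in> orthogonal_comp (Dsub E) \<and>
      (\<forall>i\<in>V4. convex_on UNIV (fm 1 0 i) \<and> (\<forall>x. ereal (fm 1 0 i x) \<le> f i x))) \<and>
     (\<forall>n\<ge>1.
        connects E (Eb n) \<and>
        (\<forall>a\<in>Ebar E. a \<notin> Eb n \<longrightarrow> z n 0 (Inr a) = 0) \<and>
        (\<forall>a\<in>Ebar E. z n 0 (Inr a) \<in> orthogonal_comp (Hsub a) \<and>
                   norm (z n 0 (Inr a)) \<le> Creg * norm (vH E (z n 0))) \<and>
        vH E (z (Suc n) 0) = vH E (z n wbar) \<and>
        (\<forall>i. z (Suc n) 0 (Inl i) = z n wbar (Inl i)) \<and>
        (\<forall>i\<in>V4. fm (Suc n) 0 i = fm n wbar i)) \<and>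
     (\<forall>n\<ge>1. \<forall>w\<in>{1..wbar}.
        S n w \<noteq> {} \<and> S n w \<subseteq> UNIV <+> Eb n \<and>
        (if S n w \<subseteq> Inl ` V4
         then subgradient_step E f V4 xbar (S n w) (fm n (w-1)) (z n (w-1)) (fm n w) (z n w)
         else proximal_step E f V4 xbar (S n w) (fm n (w-1)) (z n (w-1)) (fm n w) (z n w)) \<and>
        (\<forall>\<alpha> \<in> UNIV <+> Ebar E. \<alpha> \<notin> S n w \<longrightarrow> z n w \<alpha> = z n (w-1) \<alpha>))"

definition last_update ::
    "nat \<Rightarrow> (nat \<Rightarrow> nat \<Rightarrow> ('v, 'm) idx set) \<Rightarrow> nat \<Rightarrow> ('v, 'm) idx \<Rightarrow> nat" where
  "last_update wbar S n \<alpha> = Max {w \<in> {1..wbar}. \<alpha> \<in> S n w}"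

definition assumption_A1 ::
    "'v set set \<Rightarrow> 'v set \<Rightarrow> real^'m^'v::finite \<Rightarrow> nat \<Rightarrow> (nat \<Rightarrow> nat \<Rightarrow> ('v, 'm) idx set)
      \<Rightarrow> (nat \<Rightarrow> nat \<Rightarrow> 'v \<Rightarrow> real^'m \<Rightarrow> real)
      \<Rightarrow> (nat \<Rightarrow> nat \<Rightarrow> ('v, 'm) idx \<Rightarrow> real^'m^'v) \<Rightarrow> bool" where
  "assumption_A1 E V4 xbar wbar S fm z \<longleftrightarrow>
     (\<forall>n\<ge>1. \<forall>w\<in>{1<..wbar}. S n w \<subseteq> Inl ` V4 \<longrightarrow>
        (\<forall>i\<in>V4. is_arg_min
           (\<lambda>y. ereal (1/2 * (norm ((xbar - vH E (z n (w-1))) $ i - y))\<^sup>2)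
                + fenchel_conj (\<lambda>x. ereal (fm n (w-1) i x)) y)
           (\<lambda>_. True) (z n (w-1) (Inl i) $ i)))"

definition assumption_A2 ::
    "'v::finite set \<Rightarrow> nat \<Rightarrow> (nat \<Rightarrow> nat \<Rightarrow> ('v, 'm::finite) idx set) \<Rightarrow> bool" where
  "assumption_A2 V4 wbar S \<longleftrightarrow>
     (\<forall>n\<ge>1. \<forall>i\<in>V4. \<forall>w\<in>{last_update wbar S n (Inl i) <.. wbar}. \<forall>a. Inr a \<in> S n w \<longrightarrow>
        (\<forall>v \<in> orthogonal_comp (Hsub a :: (real^'m^'v) set). v $ i = 0))"

definition assumption_A3 :: "'v set \<Rightarrow> (nat \<Rightarrow> nat \<Rightarrow> ('v, 'm) idx set) \<Rightarrow> bool" where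
  "assumption_A3 V4 S \<longleftrightarrow> (V4 \<noteq> {} \<longrightarrow> (\<forall>n>1. S n 1 = Inl ` V4))"

end

theory Submission
  imports Defs
begin

text \<open>The dual values of the run decrease monotonically, and everything rests on comparing, over two
consecutive cycles, this decrease with the distance \<open>a n\<close> of the value at the start of cycle \<open>n\<close>
from the optimal dual value. The goal is the recurrence \<open>(a (n + 2))\<^sup>2 \<le> K * (a n - a (n + 2))\<close>, from
which \<open>a n \<le> A / n\<close> follows by an elementary induction (\<open>sublinear_rate\<close>).

How much a step gains. A block minimization yields, for each dual variable in the block, a
subgradient inequality of the conjugate at the new variable, with the new primal point \<open>x\<close> as
subgradient (\<open>block_minimizer_subgradient\<close>). Summing these inequalities at the old variables shows
that the dual value drops by at least half the squared distance between the old and the new primal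
point. The subgradient step enjoys the same bound: once the minorant \<open>m\<close> of a vertex is affine with
slope the dual variable, \<open>q\<close> minimizes the old proximal subproblem, and the drop of the dual value
is the rise of the optimal primal value when \<open>m\<close> is replaced by the maximum of \<open>m\<close> and the new
linearization. Bounding that maximum from below by the convex combination with weight \<open>t\<close> gives
moreover a gain of at least \<open>t * \<delta> - t\<^sup>2 / 2 * (norm (s - p))\<^sup>2\<close>, where \<open>\<delta>\<close> is the gap between the
function and its minorant at \<open>q\<close>, \<open>s\<close> is the subgradient chosen there and \<open>p\<close> is the slope of \<open>m\<close>
(\<open>subgradient_update_descent\<close>). Optimizing over \<open>t\<close>, with \<open>s\<close> and \<open>p\<close> bounded, bounds \<open>\<delta>\<close> by a
multiple of the square root of the gain (\<open>gap_le_sqrt\<close>).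

How far the end of a cycle is from optimal. Each dual variable outside \<open>V4\<close> was optimal for the
primal point at its last update, and by the first gain estimate that point is within a multiple of
the square root of the decrease in the cycle of the primal point at the end of the cycle. For a
vertex in \<open>V4\<close> the affine minorant is exact in the Fenchel inequality at every point, so that only
the gap \<open>\<delta>\<close> at the final primal point is lost. Adding these estimates and the convexity inequality
for the quadratic term bounds \<open>a (n + 1)\<close> by a multiple of the square root of the decrease in cycle
\<open>n\<close> plus the sum of the gaps (\<open>cycle_gap_bound\<close>). The next cycle starts from the same primal point by a
subgradient step on all of \<open>V4\<close>, so these gaps are in turn bounded by the square root of the
decrease in cycle \<open>n + 1\<close> (\<open>minorant_gap_bound\<close>), and the recurrence follows.

Two points need care. The edge components of the dual optimizer may live on edges that a cycle does
not use; since only their sum enters the dual value, they are redistributed over the connecting set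
of the cycle, with uniformly bounded norms (\<open>redistributed_optimizer\<close>). And nothing forces the
initial dual value to be finite: finiteness holds only after each variable has been updated once,
that is from the second cycle on, and all minorants are affine from the start of the third.\<close>

section \<open>Elementary inequalities\<close>

text \<open>Turns a first-order comparison along a segment into an inequality for the derivative.\<close>

lemma le_if_le_add_small:
  fixes a b c :: real
  assumes "\<And>t. 0 < t \<Longrightarrow> t \<le> 1 \<Longrightarrow> a \<le> b + t * c"
  shows "a \<le> b"
proof (rule field_le_epsilon)
  fix e :: real assume "e > 0"
  define t where "t = min 1 (e / (\<bar>c\<bar> + 1))"
  have t: "0 < t" "t \<le> 1" "t \<le> e / (\<bar>c\<bar> + 1)" using \<open>e > 0\<close> by (auto simp: t_def)
  have "t * c \<le> t * (\<bar>c\<bar> + 1)" using t by (intro mult_left_mono) auto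
  also have "\<dots> \<le> e" using t(3) by (simp add: pos_le_divide_eq)
  finally show "a \<le> b + e" using assms[OF t(1,2)] by linarith
qed

lemma norm_diff_scaleR_sq:
  fixes r d :: "'a::real_inner"
  shows "(norm (r - t *\<^sub>R d))\<^sup>2 = (norm r)\<^sup>2 - 2 * t * (r \<bullet> d) + t\<^sup>2 * (norm d)\<^sup>2"
  by (simp only: power2_norm_eq_inner)
    (simp add: inner_diff_left inner_diff_right inner_commute algebra_simps power2_eq_square)

text \<open>Finiteness of a conjugate is exploited by testing with arbitrary multiples of one direction.\<close>

lemma no_unbounded_multiple:
  fixes a b :: real
  assumes "\<And>t. t * a \<le> b" "a \<ge> 0"
  shows "a = 0"
proof (rule ccontr)
  assume "a \<noteq> 0"
  thus False using assms(1)[of "(\<bar>b\<bar> + 1) / a"] by auto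
qed

text \<open>For \<open>D > 0\<close> the choice \<open>t = sqrt (D / M)\<close> is admissible because \<open>D \<le> M\<close>, and it balances
\<open>\<delta> \<le> D / t + t * B\<^sup>2 / 2\<close> so that both terms are of order \<open>sqrt D\<close>; for \<open>D = 0\<close> let \<open>t\<close> tend
to 0.\<close>

lemma gap_le_sqrt:
  fixes \<delta> b D M B :: real
  assumes t: "\<And>t. t \<in> {0..1} \<Longrightarrow> t * \<delta> - t\<^sup>2 / 2 * b\<^sup>2 \<le> D" and b: "0 \<le> b" "b \<le> B"
    and D: "0 \<le> D" "D \<le> M" and M: "M > 0"
  shows "\<delta> \<le> (sqrt M + B\<^sup>2 / (2 * sqrt M)) * sqrt D"
proof -
  have bB: "b\<^sup>2 \<le> B\<^sup>2" using b by (intro power_mono) auto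
  have *: "\<delta> \<le> D / t + t * (B\<^sup>2 / 2)" if "0 < t" "t \<le> 1" for t
  proof -
    have "t * \<delta> \<le> D + t\<^sup>2 / 2 * b\<^sup>2" using t[of t] that by simp
    also have "\<dots> \<le> D + t\<^sup>2 / 2 * B\<^sup>2" using bB by (intro add_left_mono mult_left_mono) auto
    also have "\<dots> = t * (D / t + t * (B\<^sup>2 / 2))" using that by (simp add: power2_eq_square field_simps)
    finally show ?thesis using that by (simp only: mult_le_cancel_left_pos)
  qed
  show ?thesis
  proof (cases "D = 0")
    case True
    have "\<delta> \<le> 0" by (rule le_if_le_add_small[where c = "B\<^sup>2 / 2"]) (use * True in auto)
    thus ?thesis using True by simp
  next
    case False
    define t where "t = sqrt D / sqrt M"
    have "D / t = (D / sqrt D) * sqrt M" by (simp add: t_def)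
    also have "\<dots> = sqrt M * sqrt D" using D(1) by (simp add: real_div_sqrt)
    finally have "D / t = sqrt M * sqrt D" .
    moreover have "0 < t" "t \<le> 1" using False D M by (auto simp: t_def divide_simps)
    ultimately have "\<delta> \<le> sqrt M * sqrt D + t * (B\<^sup>2 / 2)" using * by metis
    also have "\<dots> = (sqrt M + B\<^sup>2 / (2 * sqrt M)) * sqrt D" by (simp add: t_def field_simps)
    finally show ?thesis .
  qed
qed

text \<open>A sequence with \<open>a' \<le> - a\<^sup>2 / K\<close> decays like \<open>1 / n\<close>; this is the discrete form with step two, whence
the two initial values in the constant. If the bound failed at \<open>n = k + 2\<close>, the decrease from \<open>k\<close> to
\<open>n\<close> would exceed what the bound at \<open>k\<close> leaves.\<close>

lemma sublinear_rate:
  fixes a :: "nat \<Rightarrow> real"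
  assumes K: "K > 0"
    and rec: "\<And>n. n \<ge> N \<Longrightarrow> (a (n + 2))\<^sup>2 \<le> K * (a n - a (n + 2))" and N: "N \<ge> 2"
  shows "\<exists>A. \<forall>n\<ge>N. a n \<le> A / real n"
proof -
  define A where "A = Max {4 * K, real N * a N, real (N + 1) * a (N + 1)}"
  have A: "4 * K \<le> A" "real N * a N \<le> A" "real (N + 1) * a (N + 1) \<le> A" by (auto simp: A_def)
  have "a n \<le> A / real n" if "n \<ge> N" for n
    using that
  proof (induction n rule: less_induct)
    case (less n)
    have "n = N \<or> n = N + 1 \<or> n = (n - 2) + 2 \<and> n - 2 \<ge> N" using less.prems by arith
    then consider "n = N" | "n = N + 1" | k where "n = k + 2" "k \<ge> N" by blast
    thus ?case
    proof cases
      case 1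
      thus ?thesis using A(2) N by (simp add: pos_le_divide_eq mult.commute)
    next
      case 2
      thus ?thesis using A(3) N by (simp add: pos_le_divide_eq mult.commute)
    next
      case 3
      show ?thesis
      proof (rule ccontr)
        assume neg: "\<not> a n \<le> A / real n"
        define r where "r = real n"
        have r: "r \<ge> 4" "real k = r - 2" using 3 N by (auto simp: r_def)
        have A0: "A > 0" using A(1) K by simp
        have "a k \<le> A / (r - 2)" using less.IH[of k] 3 r by simp
        moreover have "(A / r)\<^sup>2 \<le> (a n)\<^sup>2"
          using neg A0 r by (intro power_mono) (auto simp: r_def)
        moreover have "(a n)\<^sup>2 \<le> K * (a k - a n)" using rec[of k] 3 by simp
        moreover have "a n > A / r" using neg by (simp add: r_def)
        ultimately have "(A / r)\<^sup>2 < K * (A / (r - 2) - A / r)"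
          using K by (smt (verit) mult_less_cancel_left_pos)
        also have "A / (r - 2) - A / r = 2 * A / (r * (r - 2))"
          using r by (simp add: divide_simps) (simp add: algebra_simps)
        also have "K * (2 * A / (r * (r - 2))) \<le> (A / 4) * (2 * A / (r * (r - 2)))"
          using A A0 r by (intro mult_right_mono) auto
        also have "\<dots> = A\<^sup>2 / (2 * r * (r - 2))" by (simp add: power2_eq_square)
        also have "\<dots> \<le> A\<^sup>2 / (r * r)"
        proof (rule divide_left_mono)
          have "r * r \<le> r * (2 * (r - 2))" using r by (intro mult_left_mono) auto
          thus "r * r \<le> 2 * r * (r - 2)" by (simp add: algebra_simps)
          show "0 < 2 * r * (r - 2) * (r * r)" using r by simp
        qed simp
        finally show False by (simp add: power_divide power2_eq_square)
      qed
    qed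
  qed
  thus ?thesis by blast
qed

section \<open>Convex functions and Fenchel conjugates\<close>

lemma convex_on_max:
  fixes g h :: "'a::real_vector \<Rightarrow> real"
  assumes g: "convex_on A g" and h: "convex_on A h"
  shows "convex_on A (\<lambda>x. max (g x) (h x))"
proof (rule convex_onI)
  fix t :: real and x y assume t: "0 < t" "t < 1" and A: "x \<in> A" "y \<in> A"
  let ?M = "\<lambda>x. max (g x) (h x)"
  have "g ((1 - t) *\<^sub>R x + t *\<^sub>R y) \<le> (1 - t) * g x + t * g y"
    using convex_onD[OF g] t A by simp
  also have "\<dots> \<le> (1 - t) * ?M x + t * ?M y" using t by (intro add_mono mult_left_mono) auto
  finally have gM: "g ((1 - t) *\<^sub>R x + t *\<^sub>R y) \<le> (1 - t) * ?M x + t * ?M y" .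
  have "h ((1 - t) *\<^sub>R x + t *\<^sub>R y) \<le> (1 - t) * h x + t * h y"
    using convex_onD[OF h] t A by simp
  also have "\<dots> \<le> (1 - t) * ?M x + t * ?M y" using t by (intro add_mono mult_left_mono) auto
  finally have "h ((1 - t) *\<^sub>R x + t *\<^sub>R y) \<le> (1 - t) * ?M x + t * ?M y" .
  with gM show "?M ((1 - t) *\<^sub>R x + t *\<^sub>R y) \<le> (1 - t) * ?M x + t * ?M y" by simp
qed (rule convex_on_imp_convex[OF g])

text \<open>The way in which conjugates are handled below: an upper bound on the conjugate is an affine
minorant, and no arithmetic with infinities remains.\<close>

lemma fenchel_conj_le_iff:
  "fenchel_conj g y \<le> ereal A \<longleftrightarrow> (\<forall>x. ereal (y \<bullet> x - A) \<le> g x)"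
proof -
  have "ereal (y \<bullet> x) - g x \<le> ereal A \<longleftrightarrow> ereal (y \<bullet> x - A) \<le> g x" for x
    by (cases "g x") auto
  thus ?thesis by (simp add: fenchel_conj_def SUP_le_iff)
qed

lemma fenchel_conj_ge: "ereal (y \<bullet> x) - g x \<le> fenchel_conj g y"
  unfolding fenchel_conj_def by (rule SUP_upper) simp

lemma fenchel_conj_gt_MInf: "g x \<noteq> \<infinity> \<Longrightarrow> fenchel_conj g y \<noteq> -\<infinity>"
  using fenchel_conj_ge[of y x g] by (cases "g x") auto

lemma fenchel_conj_antimono: "(\<And>x. g x \<le> g' x) \<Longrightarrow> fenchel_conj g' y \<le> fenchel_conj g y"
  unfolding fenchel_conj_def by (intro SUP_mono) (auto intro!: ereal_minus_mono)

lemma fenchel_conj_convex: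
  assumes "fenchel_conj g y1 \<le> ereal A1" "fenchel_conj g y2 \<le> ereal A2" "0 \<le> t" "t \<le> 1"
  shows "fenchel_conj g ((1 - t) *\<^sub>R y1 + t *\<^sub>R y2) \<le> ereal ((1 - t) * A1 + t * A2)"
  unfolding fenchel_conj_le_iff
proof
  fix x
  have "ereal (y1 \<bullet> x - A1) \<le> g x" "ereal (y2 \<bullet> x - A2) \<le> g x"
    using assms by (auto simp: fenchel_conj_le_iff)
  hence *: "ereal (max (y1 \<bullet> x - A1) (y2 \<bullet> x - A2)) \<le> g x" by (simp add: max_def)
  have "((1 - t) *\<^sub>R y1 + t *\<^sub>R y2) \<bullet> x - ((1 - t) * A1 + t * A2)
      = (1 - t) * (y1 \<bullet> x - A1) + t * (y2 \<bullet> x - A2)"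
    by (simp add: inner_add_left algebra_simps)
  also have "\<dots> \<le> max (y1 \<bullet> x - A1) (y2 \<bullet> x - A2)"
    using assms by (intro convex_bound_le) auto
  finally show "ereal (((1 - t) *\<^sub>R y1 + t *\<^sub>R y2) \<bullet> x - ((1 - t) * A1 + t * A2)) \<le> g x"
    using * by (meson ereal_less_eq(3) order_trans)
qed

text \<open>The minorant comes from a hyperplane that separates the epigraph from a point just below it. It
strictly separates two points of the same vertical line, so it is not vertical and is the graph of an
affine function.\<close>

lemma fenchel_conj_proper:
  fixes g :: "'a::euclidean_space \<Rightarrow> ereal"
  assumes g: "closed_convex_fun g" and x0: "g x0 \<noteq> \<infinity>"
  shows "\<exists>y A. fenchel_conj g y \<le> ereal A"
proof -
  define epi where "epi = {(x, r::real). g x \<le> ereal r}"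
  obtain r0 where r0: "g x0 = ereal r0"
    using g x0 by (cases "g x0") (auto simp: closed_convex_fun_def)
  have "convex epi" "closed epi" using g by (auto simp: closed_convex_fun_def epi_def)
  moreover have "(x0, r0 - 1) \<notin> epi" by (simp add: epi_def r0)
  ultimately obtain ab \<beta> where sep: "ab \<bullet> (x0, r0 - 1) < \<beta>" "\<forall>v\<in>epi. ab \<bullet> v > \<beta>"
    using separating_hyperplane_closed_point by blast
  obtain a b where ab: "ab = (a, b)" by (cases ab)
  have "(x0, r0) \<in> epi" by (simp add: epi_def r0)
  hence "a \<bullet> x0 + b * r0 > \<beta>" using sep(2) ab by auto
  moreover have "a \<bullet> x0 + b * (r0 - 1) < \<beta>" using sep(1) ab by auto
  ultimately have b: "b > 0" by (simp add: algebra_simps)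
  have "ereal ((- a /\<^sub>R b) \<bullet> x - (- \<beta> / b)) \<le> g x" for x
  proof (cases "g x")
    case (real r)
    hence "(x, r) \<in> epi" by (simp add: epi_def)
    hence "a \<bullet> x + b * r > \<beta>" using sep(2) ab by auto
    hence "(\<beta> - a \<bullet> x) / b \<le> r" using b by (simp add: pos_divide_le_eq algebra_simps)
    moreover have "(- a /\<^sub>R b) \<bullet> x - (- \<beta> / b) = (\<beta> - a \<bullet> x) / b"
      by (simp add: divide_inverse algebra_simps)
    ultimately show ?thesis using real by simp
  qed (use g in \<open>auto simp: closed_convex_fun_def\<close>)
  thus ?thesis by (metis fenchel_conj_le_iff)
qed

lemma closed_convex_fun_real:
  fixes m :: "'a::euclidean_space \<Rightarrow> real"
  assumes "convex_on UNIV m"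
  shows "closed_convex_fun (\<lambda>x. ereal (m x))"
proof -
  have "continuous_on UNIV m" by (rule convex_on_continuous[OF open_UNIV assms])
  hence "continuous_on UNIV (\<lambda>p :: 'a \<times> real. m (fst p))"
    by (rule continuous_on_compose2) (auto intro: continuous_intros)
  hence "closed {p :: 'a \<times> real. m (fst p) \<le> snd p}"
    by (intro closed_Collect_le continuous_on_snd continuous_on_id) auto
  also have "{p :: 'a \<times> real. m (fst p) \<le> snd p} = {(x, r). m x \<le> r}" by auto
  finally have "closed {(x, r::real). m x \<le> r}" .
  moreover have "{(x, r::real). m x \<le> r} = epigraph UNIV m" by (auto simp: epigraph_def)
  ultimately show ?thesis
    using assms by (simp add: closed_convex_fun_def convex_epigraph)
qed

lemma convex_on_real_of_closed_convex_fun: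
  fixes g :: "'a::euclidean_space \<Rightarrow> ereal"
  assumes g: "closed_convex_fun g" and fin: "\<And>x. g x < \<infinity>"
  shows "convex_on UNIV (\<lambda>x. real_of_ereal (g x))"
proof -
  have "\<bar>g x\<bar> \<noteq> \<infinity>" for x using g fin[of x] by (auto simp: closed_convex_fun_def)
  hence "g x \<le> ereal r \<longleftrightarrow> real_of_ereal (g x) \<le> r" for x r
    by (metis ereal_less_eq(3) ereal_real')
  hence "{(x, r::real). g x \<le> ereal r} = epigraph UNIV (\<lambda>x. real_of_ereal (g x))"
    by (auto simp: epigraph_def)
  thus ?thesis using g by (simp add: closed_convex_fun_def convex_epigraph)
qed

text \<open>Stepping from \<open>q\<close> by a unit vector in the direction of \<open>s\<close> raises the function by at least
\<open>norm s\<close>, while a finite convex function is continuous, hence bounded on balls.\<close>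

lemma subdifferential_locally_bounded:
  fixes g :: "'a::euclidean_space \<Rightarrow> ereal"
  assumes g: "closed_convex_fun g" and fin: "\<And>x. g x < \<infinity>"
  shows "\<exists>B. \<forall>q s. norm q \<le> R \<longrightarrow> s \<in> subdifferential g q \<longrightarrow> norm s \<le> B"
proof -
  define k where "k = (\<lambda>x. real_of_ereal (g x))"
  have gk: "g x = ereal (k x)" for x
    using g fin[of x] by (cases "g x") (auto simp: closed_convex_fun_def k_def)
  have "convex_on UNIV k"
    unfolding k_def by (rule convex_on_real_of_closed_convex_fun[OF g fin])
  hence "continuous_on UNIV k" by (intro convex_on_continuous) auto
  hence "compact (k ` cball 0 (R + 1))"
    by (intro compact_continuous_image) (auto intro: continuous_on_subset)
  then obtain B where B: "\<And>x. norm x \<le> R + 1 \<Longrightarrow> \<bar>k x\<bar> \<le> B"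
    using compact_imp_bounded[of "k ` cball 0 (R + 1)"] by (force simp: bounded_iff)
  have "norm s \<le> 2 * B" if q: "norm q \<le> R" and s: "s \<in> subdifferential g q" for q s
  proof (cases "s = 0")
    case True thus ?thesis using B[of q] q by simp
  next
    case False
    define y where "y = q + s /\<^sub>R norm s"
    have "norm y \<le> norm q + norm (s /\<^sub>R norm s)" unfolding y_def by (rule norm_triangle_ineq)
    also have "\<dots> \<le> R + 1" using False q by simp
    finally have y: "norm y \<le> R + 1" .
    have "k q + s \<bullet> (y - q) \<le> k y" using s by (auto simp: subdifferential_def gk)
    moreover have "s \<bullet> (y - q) = norm s"
      using False by (simp add: y_def power2_norm_eq_inner[symmetric] power2_eq_square)
    ultimately show ?thesis using B[of q] B[OF y] q by simp
  qed
  thus ?thesis by blast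
qed

lemma subspace_Hsub: "subspace (Hsub a)"
proof -
  obtain e k where "a = (e, k)" by (cases a)
  hence mem: "x \<in> Hsub a \<longleftrightarrow> (\<forall>i\<in>e. \<forall>j\<in>e. x $ i $ k = x $ j $ k)" for x
    by (simp add: Hsub_def)
  show ?thesis
  proof (rule subspaceI)
    show "0 \<in> Hsub a" by (simp add: mem)
    fix x y assume x: "x \<in> Hsub a"
    show "c *\<^sub>R x \<in> Hsub a" for c
      unfolding mem vector_scaleR_component using x[unfolded mem] by metis
    assume y: "y \<in> Hsub a"
    show "x + y \<in> Hsub a"
      unfolding mem vector_add_component using x[unfolded mem] y[unfolded mem] by metis
  qed
qed

lemma conj_subspace_indicator:
  assumes "subspace H" "y \<in> orthogonal_comp H"
  shows "fenchel_conj (conv_indicator H) y = 0"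
proof (rule antisym)
  have "y \<bullet> x = 0" if "x \<in> H" for x
    using that assms(2) by (auto simp: orthogonal_comp_def orthogonal_def inner_commute)
  hence "fenchel_conj (conv_indicator H) y \<le> ereal 0"
    by (auto simp: fenchel_conj_le_iff conv_indicator_def)
  thus "fenchel_conj (conv_indicator H) y \<le> 0" by (simp add: zero_ereal_def)
  show "0 \<le> fenchel_conj (conv_indicator H) y"
    using fenchel_conj_ge[of y 0 "conv_indicator H"] subspace_0[OF assms(1)]
    by (simp add: conv_indicator_def zero_ereal_def[symmetric])
qed

lemma conj_subspace_indicator_finite:
  assumes H: "subspace H" and y: "fenchel_conj (conv_indicator H) y \<le> ereal A"
  shows "y \<in> orthogonal_comp H"
proof -
  have "y \<bullet> x = 0" if "x \<in> H" for x
  proof -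
    have "t * (y \<bullet> x)\<^sup>2 \<le> A" for t
    proof -
      have "(t * (y \<bullet> x)) *\<^sub>R x \<in> H" using H that by (rule subspace_mul)
      hence "y \<bullet> ((t * (y \<bullet> x)) *\<^sub>R x) - A \<le> 0"
        using y[unfolded fenchel_conj_le_iff, rule_format, of "(t * (y \<bullet> x)) *\<^sub>R x"]
        by (simp add: conv_indicator_def)
      thus ?thesis by (simp add: power2_eq_square)
    qed
    hence "(y \<bullet> x)\<^sup>2 = 0" by (rule no_unbounded_multiple) simp
    thus ?thesis by simp
  qed
  thus ?thesis by (auto simp: orthogonal_comp_def orthogonal_def inner_commute)
qed

section \<open>Conjugates of functions of one component\<close>

lemma lift_fun_simps [simp]:
  "lift_fun g (Inl i) = (\<lambda>x. g i (x $ i))"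
  "lift_fun g (Inr a) = conv_indicator (Hsub a)"
  by (auto simp: lift_fun_def)

lemma inner_supported:
  fixes y x :: "real^'m^'v::finite"
  assumes "\<And>j. j \<noteq> i \<Longrightarrow> y $ j = 0"
  shows "y \<bullet> x = y $ i \<bullet> x $ i"
proof -
  have "y \<bullet> x = (\<Sum>j\<in>UNIV. y $ j \<bullet> x $ j)" by (simp add: inner_vec_def)
  also have "\<dots> = (\<Sum>j\<in>UNIV. if j = i then y $ i \<bullet> x $ i else 0)"
    by (intro sum.cong) (auto simp: assms)
  finally show ?thesis by simp
qed

lemma half_norm_sq_vec: "1/2 * (norm x)\<^sup>2 = (\<Sum>i\<in>UNIV. 1/2 * (norm (x $ i))\<^sup>2)"
  for x :: "real^'m^'v::finite"
  by (simp add: norm_vec_def L2_set_def sum_nonneg sum_distrib_left)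

text \<open>A function that depends on the component \<open>i\<close> only is constant in all other directions, so its conjugate
is infinite off the vectors supported at \<open>i\<close>.\<close>

lemma lifted_conj_support:
  fixes y :: "real^'m^'v::finite"
  assumes y: "fenchel_conj (lift_fun g (Inl i)) y \<le> ereal A" and x0: "g i x0 \<noteq> \<infinity>" and "j \<noteq> i"
  shows "y $ j = 0"
proof -
  obtain r where r: "g i x0 \<le> ereal r" using x0 by (cases "g i x0") auto
  have "t * (y $ j \<bullet> y $ j) \<le> r + A - y $ i \<bullet> x0" for t
  proof -
    define x where "x = axis i x0 + t *\<^sub>R axis j (y $ j)"
    have "ereal (y \<bullet> x - A) \<le> g i (x $ i)" using y by (simp add: fenchel_conj_le_iff)
    moreover have "x $ i = x0" using \<open>j \<noteq> i\<close> by (simp add: x_def axis_def)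
    ultimately have "y \<bullet> x - A \<le> r" using r by (metis ereal_less_eq(3) order_trans)
    thus ?thesis by (simp add: x_def inner_add_right inner_axis)
  qed
  hence "y $ j \<bullet> y $ j = 0" by (rule no_unbounded_multiple) simp
  thus ?thesis by simp
qed

lemma lifted_conj_proper:
  fixes g :: "'v::finite \<Rightarrow> real^'m::finite \<Rightarrow> ereal"
  assumes "closed_convex_fun (g i)" "g i x0 \<noteq> \<infinity>"
  shows "\<exists>y A. fenchel_conj (lift_fun g (Inl i)) y \<le> ereal A"
proof -
  obtain y A where "fenchel_conj (g i) y \<le> ereal A" using fenchel_conj_proper[OF assms] by blast
  hence "fenchel_conj (lift_fun g (Inl i)) (axis i y) \<le> ereal A"
    by (auto simp: fenchel_conj_le_iff inner_commute[of "axis i y"] inner_axis)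
      (metis inner_commute)
  thus ?thesis by blast
qed

definition affine_with_slope :: "('a::real_inner \<Rightarrow> real) \<Rightarrow> 'a \<Rightarrow> bool" where
  "affine_with_slope m p \<longleftrightarrow> (\<forall>x. m x = m 0 + p \<bullet> x)"

lemma affine_with_slope_convex:
  assumes "affine_with_slope m p" shows "convex_on UNIV m"
proof -
  have "m = (\<lambda>x. m 0 + p \<bullet> x)" using assms unfolding affine_with_slope_def by blast
  moreover have "convex_on UNIV (\<lambda>x. m 0 + p \<bullet> x)"
    by (intro convex_onI) (auto simp: inner_add_right algebra_simps)
  ultimately show ?thesis by (rule ssubst[where P = "convex_on UNIV"])
qed

lemma lifted_conj_affine:
  fixes y :: "real^'m^'v::finite"
  assumes y: "\<And>j. j \<noteq> i \<Longrightarrow> y $ j = 0" and m: "affine_with_slope m (y $ i)" and g: "g i = (\<lambda>x. ereal (m x))"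
  shows "fenchel_conj (lift_fun g (Inl i)) y = ereal (- m 0)"
proof -
  have "ereal (y \<bullet> x) - lift_fun g (Inl i) x = ereal (- m 0)" for x
    using m[unfolded affine_with_slope_def, rule_format, of "x $ i"]
    by (simp add: g inner_supported[of i y, OF y])
  thus ?thesis unfolding fenchel_conj_def by (simp only:) simp
qed

text \<open>The conjugate of an affine function is finite only at its slope; therefore a block minimization
cannot move the dual variable of a vertex whose minorant is affine.\<close>

lemma lifted_conj_affine_slope:
  fixes y :: "real^'m^'v::finite"
  assumes y: "fenchel_conj (lift_fun g (Inl i)) y \<le> ereal A"
    and m: "affine_with_slope m p" and g: "g i = (\<lambda>x. ereal (m x))"
  shows "y $ i = p"
proof -
  have "t * ((y $ i - p) \<bullet> (y $ i - p)) \<le> m 0 + A" for t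
  proof -
    define x where "x = (axis i (t *\<^sub>R (y $ i - p)) :: real^'m^'v)"
    have "y \<bullet> x - A \<le> m (x $ i)" using y by (simp add: fenchel_conj_le_iff g)
    moreover have "m (x $ i) = m 0 + p \<bullet> x $ i" using m unfolding affine_with_slope_def by blast
    moreover have "x $ i = t *\<^sub>R (y $ i - p)" by (simp add: x_def axis_def)
    moreover have "y \<bullet> x = y $ i \<bullet> (t *\<^sub>R (y $ i - p))" by (simp add: x_def inner_axis)
    ultimately have "t * (y $ i \<bullet> (y $ i - p)) - t * (p \<bullet> (y $ i - p)) \<le> m 0 + A" by simp
    thus ?thesis by (simp add: inner_diff_left right_diff_distrib)
  qed
  hence "(y $ i - p) \<bullet> (y $ i - p) = 0" by (rule no_unbounded_multiple) simp
  thus ?thesis by simp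
qed

section \<open>Optimality conditions of the two kinds of updates\<close>

text \<open>Optimality condition of the proximal subproblem, by comparison with points of the segment towards
the competitor.\<close>

lemma proximal_point_subgradient:
  fixes g :: "'a::real_inner \<Rightarrow> real"
  assumes g: "convex_on UNIV g"
    and p: "is_arg_min (\<lambda>x. 1/2 * (norm (c - x))\<^sup>2 + g x) (\<lambda>_. True) p"
  shows "g p + (c - p) \<bullet> (x - p) \<le> g x"
proof -
  have "(c - p) \<bullet> (x - p) \<le> (g x - g p) + t * ((norm (x - p))\<^sup>2 / 2)" if t: "0 < t" "t \<le> 1" for t
  proof -
    define u where "u = (1 - t) *\<^sub>R p + t *\<^sub>R x"
    have "1/2 * (norm (c - p))\<^sup>2 + g p \<le> 1/2 * (norm (c - u))\<^sup>2 + g u"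
      using p by (simp add: is_arg_min_linorder)
    moreover have "g u \<le> (1 - t) * g p + t * g x"
      unfolding u_def using t by (intro convex_onD[OF g]) auto
    moreover have "c - u = (c - p) - t *\<^sub>R (x - p)" by (simp add: u_def algebra_simps)
    hence "(norm (c - u))\<^sup>2 = (norm (c - p))\<^sup>2 - 2 * t * ((c - p) \<bullet> (x - p)) + t\<^sup>2 * (norm (x - p))\<^sup>2"
      by (simp only: norm_diff_scaleR_sq)
    ultimately have "t * ((c - p) \<bullet> (x - p)) \<le> t * ((g x - g p) + t * ((norm (x - p))\<^sup>2 / 2))"
      by (simp add: algebra_simps power2_eq_square)
    thus ?thesis using t by simp
  qed
  hence "(c - p) \<bullet> (x - p) \<le> g x - g p" by (rule le_if_le_add_small)
  thus ?thesis by simp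
qed

text \<open>Optimality condition of a block minimization in the dual. Properness of the conjugates makes the
minimal value, and therefore each summand at the minimizer, finite; moving a single component
towards \<open>y\<close> then gives the subgradient inequality for that component.\<close>

lemma block_minimizer_subgradient:
  fixes F :: "'i \<Rightarrow> 'a::real_inner \<Rightarrow> ereal"
  assumes S: "finite S" "\<alpha> \<in> S"
    and argmin: "is_arg_min (\<lambda>\<xi>. ereal (1/2 * (norm (p - (\<Sum>\<alpha>\<in>S. \<xi> \<alpha>)))\<^sup>2)
                    + (\<Sum>\<alpha>\<in>S. fenchel_conj (F \<alpha>) (\<xi> \<alpha>))) (\<lambda>_. True) \<zeta>"
    and dom: "\<And>\<alpha>. \<alpha> \<in> S \<Longrightarrow> \<exists>x. F \<alpha> x \<noteq> \<infinity>"
    and proper: "\<And>\<alpha>. \<alpha> \<in> S \<Longrightarrow> \<exists>y A. fenchel_conj (F \<alpha>) y \<le> ereal A"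
  shows "\<exists>v. fenchel_conj (F \<alpha>) (\<zeta> \<alpha>) = ereal v \<and>
           (\<forall>y A. fenchel_conj (F \<alpha>) y \<le> ereal A \<longrightarrow> v + (p - (\<Sum>\<alpha>\<in>S. \<zeta> \<alpha>)) \<bullet> (y - \<zeta> \<alpha>) \<le> A)"
proof -
  let ?G = "\<lambda>\<alpha>. fenchel_conj (F \<alpha>)"
  let ?Q = "\<lambda>\<xi>. 1/2 * (norm (p - (\<Sum>\<alpha>\<in>S. \<xi> \<alpha>)))\<^sup>2"
  have min: "ereal (?Q \<zeta>) + (\<Sum>\<alpha>\<in>S. ?G \<alpha> (\<zeta> \<alpha>)) \<le> ereal (?Q \<xi>) + (\<Sum>\<alpha>\<in>S. ?G \<alpha> (\<xi> \<alpha>))" for \<xi>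
    using argmin by (simp add: is_arg_min_linorder)
  have notM: "?G \<beta> y \<noteq> -\<infinity>" if "\<beta> \<in> S" for \<beta> y
    using dom[OF that] fenchel_conj_gt_MInf by blast
  obtain y0 A0 where y0: "\<And>\<beta>. \<beta> \<in> S \<Longrightarrow> ?G \<beta> (y0 \<beta>) \<le> ereal (A0 \<beta>)"
    using bchoice[of S "\<lambda>\<beta> yA. ?G \<beta> (fst yA) \<le> ereal (snd yA)"] proper by fastforce
  have "(\<Sum>\<beta>\<in>S. ?G \<beta> (y0 \<beta>)) \<le> (\<Sum>\<beta>\<in>S. ereal (A0 \<beta>))" by (intro sum_mono y0)
  also have "\<dots> < \<infinity>" by simp
  finally have "ereal (?Q y0) + (\<Sum>\<beta>\<in>S. ?G \<beta> (y0 \<beta>)) < \<infinity>" by simp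
  with min[of y0] have "ereal (?Q \<zeta>) + (\<Sum>\<beta>\<in>S. ?G \<beta> (\<zeta> \<beta>)) < \<infinity>" by (rule le_less_trans)
  hence "(\<Sum>\<beta>\<in>S. ?G \<beta> (\<zeta> \<beta>)) \<noteq> \<infinity>" by auto
  hence "?G \<beta> (\<zeta> \<beta>) \<noteq> \<infinity>" if "\<beta> \<in> S" for \<beta>
    using S(1) that by (auto simp: sum_Pinfty)
  with notM have "\<exists>v. ?G \<beta> (\<zeta> \<beta>) = ereal v" if "\<beta> \<in> S" for \<beta>
    using that by (cases "?G \<beta> (\<zeta> \<beta>)") auto
  then obtain v where v: "\<And>\<beta>. \<beta> \<in> S \<Longrightarrow> ?G \<beta> (\<zeta> \<beta>) = ereal (v \<beta>)" by metis
  have "v \<alpha> + (p - (\<Sum>\<alpha>\<in>S. \<zeta> \<alpha>)) \<bullet> (y - \<zeta> \<alpha>) \<le> A" if A: "?G \<alpha> y \<le> ereal A" for y A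
  proof -
    define r where "r = p - (\<Sum>\<alpha>\<in>S. \<zeta> \<alpha>)"
    define d where "d = y - \<zeta> \<alpha>"
    have "r \<bullet> d \<le> (A - v \<alpha>) + t * ((norm d)\<^sup>2 / 2)" if t: "0 < t" "t \<le> 1" for t
    proof -
      define \<xi> where "\<xi> = \<zeta>(\<alpha> := (1 - t) *\<^sub>R \<zeta> \<alpha> + t *\<^sub>R y)"
      have "(\<Sum>\<alpha>\<in>S. \<xi> \<alpha>) = (\<Sum>\<alpha>\<in>S. \<zeta> \<alpha>) + t *\<^sub>R d"
        using S by (simp add: \<xi>_def d_def sum.remove[of S \<alpha>] algebra_simps)
      hence "?Q \<xi> = 1/2 * (norm (r - t *\<^sub>R d))\<^sup>2" by (simp add: r_def algebra_simps)
      also have "\<dots> = 1/2 * (norm r)\<^sup>2 - t * (r \<bullet> d) + t\<^sup>2 * (norm d)\<^sup>2 / 2"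
        by (simp add: norm_diff_scaleR_sq algebra_simps)
      finally have Q: "?Q \<xi> = 1/2 * (norm r)\<^sup>2 - t * (r \<bullet> d) + t\<^sup>2 * (norm d)\<^sup>2 / 2" .
      have "(\<Sum>\<beta>\<in>S. ?G \<beta> (\<xi> \<beta>)) = ?G \<alpha> (\<xi> \<alpha>) + (\<Sum>\<beta>\<in>S - {\<alpha>}. ?G \<beta> (\<zeta> \<beta>))"
        using S by (simp add: sum.remove[of S \<alpha>] \<xi>_def)
      also have "(\<Sum>\<beta>\<in>S - {\<alpha>}. ?G \<beta> (\<zeta> \<beta>)) = ereal (\<Sum>\<beta>\<in>S - {\<alpha>}. v \<beta>)"
        by (simp add: v)
      also have "?G \<alpha> (\<xi> \<alpha>) \<le> ereal ((1 - t) * v \<alpha> + t * A)"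
        unfolding \<xi>_def using t A v[OF S(2)] by (simp add: fenchel_conj_convex)
      finally have "(\<Sum>\<beta>\<in>S. ?G \<beta> (\<xi> \<beta>)) \<le> ereal ((1 - t) * v \<alpha> + t * A + (\<Sum>\<beta>\<in>S - {\<alpha>}. v \<beta>))"
        by (simp add: add_right_mono)
      moreover have "(\<Sum>\<beta>\<in>S. ?G \<beta> (\<zeta> \<beta>)) = ereal (v \<alpha> + (\<Sum>\<beta>\<in>S - {\<alpha>}. v \<beta>))"
        using S by (simp add: v sum.remove[of S \<alpha>])
      ultimately have "ereal (?Q \<zeta>) + ereal (v \<alpha> + (\<Sum>\<beta>\<in>S - {\<alpha>}. v \<beta>))
          \<le> ereal (?Q \<xi>) + ereal ((1 - t) * v \<alpha> + t * A + (\<Sum>\<beta>\<in>S - {\<alpha>}. v \<beta>))"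
        using order_trans[OF min[of \<xi>] add_left_mono[of "\<Sum>\<beta>\<in>S. ?G \<beta> (\<xi> \<beta>)" _ "ereal (?Q \<xi>)"]]
        by (simp only:)
      hence "1/2 * (norm r)\<^sup>2 + v \<alpha> \<le> ?Q \<xi> + ((1 - t) * v \<alpha> + t * A)" by (simp add: r_def)
      hence "t * (r \<bullet> d) \<le> t * ((A - v \<alpha>) + t * ((norm d)\<^sup>2 / 2))"
        unfolding Q by (simp add: algebra_simps power2_eq_square)
      thus ?thesis using t by simp
    qed
    hence "r \<bullet> d \<le> A - v \<alpha>" by (rule le_if_le_add_small)
    thus ?thesis by (simp add: r_def d_def)
  qed
  thus ?thesis using v[OF S(2)] by blast
qed

lemma subgradient_update_affine:
  assumes "subgradient_update g m c q m' zp"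
  shows "affine_with_slope m' zp"
proof -
  obtain mx xp where "m' = (\<lambda>x. mx xp + (x - xp) \<bullet> zp)"
    using assms by (auto simp: subgradient_update_def)
  thus ?thesis by (simp add: affine_with_slope_def inner_diff_left inner_diff_right inner_commute)
qed

text \<open>By the optimality condition of the proximal subproblem, the new minorant supports the maximum \<open>mx\<close> at its
proximal point, and both functions in that maximum are below \<open>g\<close>.\<close>

lemma subgradient_update_minorant:
  assumes upd: "subgradient_update g m c q m' zp"
    and m: "convex_on UNIV m" "\<And>x. ereal (m x) \<le> g x"
  shows "ereal (m' x) \<le> g x"
proof -
  obtain s xp mx where s: "s \<in> subdifferential g q"
    and mx: "mx = (\<lambda>x. max (m x) (real_of_ereal (g q) + s \<bullet> (x - q)))"
    and xp: "is_arg_min (\<lambda>x. 1/2 * (norm (c - x))\<^sup>2 + mx x) (\<lambda>_. True) xp"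
    and zp: "zp = c - xp" and m': "m' = (\<lambda>x. mx xp + (x - xp) \<bullet> zp)"
    using upd unfolding subgradient_update_def by blast
  have "convex_on UNIV (\<lambda>x. real_of_ereal (g q) + s \<bullet> (x - q))"
    by (intro convex_onI) (auto simp: inner_add_right inner_diff_right algebra_simps)
  hence "convex_on UNIV mx"
    unfolding mx by (rule convex_on_max[OF m(1)])
  hence "m' x \<le> mx x"
    using proximal_point_subgradient[OF _ xp, of x] by (simp add: m' zp inner_commute)
  moreover have "ereal (mx x) \<le> g x"
  proof -
    have "g q = ereal (real_of_ereal (g q))" using s by (auto simp: subdifferential_def ereal_real)
    hence "ereal (real_of_ereal (g q) + s \<bullet> (x - q)) \<le> g x"
      using s by (metis (mono_tags, lifting) mem_Collect_eq plus_ereal.simps(1) subdifferential_def)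
    thus ?thesis using m(2)[of x] by (auto simp: mx max_def)
  qed
  ultimately show ?thesis by (meson ereal_less_eq(3) order_trans)
qed

text \<open>Here \<open>D\<close> is the decrease of the dual value of one vertex: \<open>- m 0\<close> is the conjugate of \<open>m\<close> at its slope,
and \<open>q\<close> and \<open>c - zp\<close> are the old and the new primal point. Both bounds come from the estimate \<open>main\<close>, which uses
the maximum only through its convex combinations; the first is the case \<open>t = 0\<close>, the second
completes a square.\<close>

lemma subgradient_update_descent:
  assumes upd: "subgradient_update g m c q m' zp"
    and m: "affine_with_slope m p" and q: "q = c - p"
  defines "D \<equiv> (1/2 * (norm q)\<^sup>2 - m 0) - (1/2 * (norm (c - zp))\<^sup>2 - m' 0)"
  shows "1/2 * (norm (q - (c - zp)))\<^sup>2 \<le> D"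
    and "\<exists>s\<in>subdifferential g q. \<forall>t\<in>{0..1}.
           t * (real_of_ereal (g q) - m q) - t\<^sup>2 / 2 * (norm (s - p))\<^sup>2 \<le> D"
proof -
  obtain s xp mx where s: "s \<in> subdifferential g q"
    and mx: "mx = (\<lambda>x. max (m x) (real_of_ereal (g q) + s \<bullet> (x - q)))"
    and zp: "zp = c - xp" and m': "m' = (\<lambda>x. mx xp + (x - xp) \<bullet> zp)"
    using upd unfolding subgradient_update_def by blast
  define \<delta> where "\<delta> = real_of_ereal (g q) - m q"
  have m_eq: "m x = m 0 + p \<bullet> x" for x using m unfolding affine_with_slope_def by blast
  have c: "c = q + p" using q by simp
  have sq: "(norm (q - xp))\<^sup>2 = (norm q)\<^sup>2 - 2 * (q \<bullet> xp) + (norm xp)\<^sup>2"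
    using norm_diff_scaleR_sq[of q 1 xp] by simp
  have main: "1/2 * (norm (q - xp))\<^sup>2 + t * (\<delta> + (s - p) \<bullet> (xp - q)) \<le> D" if "0 \<le> t" "t \<le> 1" for t
  proof -
    have "(1 - t) * m xp + t * (real_of_ereal (g q) + s \<bullet> (xp - q)) \<le> mx xp"
      unfolding mx using that by (intro convex_bound_le) auto
    moreover have "D = 1/2 * (norm q)\<^sup>2 - m 0 - 1/2 * (norm xp)\<^sup>2 + (mx xp - xp \<bullet> (q + p - xp))"
      by (simp add: D_def m' zp c)
    hence "D = 1/2 * (norm (q - xp))\<^sup>2 - m 0 - p \<bullet> xp + mx xp"
      unfolding sq by (simp add: inner_add_right inner_diff_right inner_commute power2_norm_eq_inner)
    hence "D = 1/2 * (norm (q - xp))\<^sup>2 - m xp + mx xp" using m_eq[of xp] by simp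
    moreover have "\<delta> + (s - p) \<bullet> (xp - q) = (real_of_ereal (g q) + s \<bullet> (xp - q)) - m xp"
      unfolding \<delta>_def m_eq[of q] m_eq[of xp] by (simp add: inner_diff_left inner_diff_right)
    ultimately show ?thesis by (simp only: right_diff_distrib) (simp add: left_diff_distrib)
  qed
  show "1/2 * (norm (q - (c - zp)))\<^sup>2 \<le> D" using main[of 0] by (simp add: zp)
  have "t * \<delta> - t\<^sup>2 / 2 * (norm (s - p))\<^sup>2 \<le> D" if "t \<in> {0..1}" for t
  proof -
    have "0 \<le> (norm ((q - xp) - t *\<^sub>R (s - p)))\<^sup>2" by simp
    also have "\<dots> = (norm (q - xp))\<^sup>2 + 2 * t * ((s - p) \<bullet> (xp - q)) + t\<^sup>2 * (norm (s - p))\<^sup>2"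
      unfolding norm_diff_scaleR_sq
      by (simp add: inner_diff_left inner_diff_right inner_commute algebra_simps)
    finally show ?thesis using main[of t] that by (simp add: algebra_simps)
  qed
  thus "\<exists>s\<in>subdifferential g q. \<forall>t\<in>{0..1}.
           t * (real_of_ereal (g q) - m q) - t\<^sup>2 / 2 * (norm (s - p))\<^sup>2 \<le> D"
    using s unfolding \<delta>_def by blast
qed

section \<open>The dual objective\<close>

lemma sum_vertices_edges:
  fixes h :: "('v::finite, 'm::finite) idx \<Rightarrow> 'b::comm_monoid_add"
  shows "(\<Sum>\<alpha>\<in>UNIV <+> Ebar E. h \<alpha>) = (\<Sum>i\<in>UNIV. h (Inl i)) + (\<Sum>a\<in>Ebar E. h (Inr a))"
  by (subst sum.Plus) (simp_all add: comp_def)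

lemma dual_obj_eq:
  "dual_obj E g xbar \<zeta> = (\<Sum>\<alpha>\<in>UNIV <+> Ebar E. fenchel_conj (lift_fun g \<alpha>) (\<zeta> \<alpha>))
     + ereal (1/2 * (norm (xbar - (\<Sum>\<alpha>\<in>UNIV <+> Ebar E. \<zeta> \<alpha>)))\<^sup>2)"
  unfolding dual_obj_def by (subst sum.Plus) (simp_all add: comp_def)

section \<open>Invariants of a run\<close>

locale dykstra_run =
  fixes E :: "'v::finite set set"
    and V4 :: "'v set"
    and f :: "'v \<Rightarrow> real^'m::finite \<Rightarrow> ereal"
    and xbar :: "real^'m^'v"
    and Creg :: real and wbar :: nat
    and Eb :: "nat \<Rightarrow> ('v set \<times> 'm) set"
    and S :: "nat \<Rightarrow> nat \<Rightarrow> ('v, 'm) idx set"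
    and fm :: "nat \<Rightarrow> nat \<Rightarrow> 'v \<Rightarrow> real^'m \<Rightarrow> real"
    and z :: "nat \<Rightarrow> nat \<Rightarrow> ('v, 'm) idx \<Rightarrow> real^'m^'v"
  assumes f_closed_convex: "closed_convex_fun (f i)"
    and f_V4: "i \<in> V4 \<Longrightarrow> f i x < \<infinity>"
    and wbar: "wbar > 0"
    and feasible: "primal_feasible E f xbar"
    and algorithm: "distributed_dykstra E f V4 xbar Creg wbar Eb S fm z"
    and Eb: "n \<ge> 1 \<Longrightarrow> Eb n = {a \<in> Ebar E. Inr a \<in> (\<Union>w\<in>{1..wbar}. S n w)}"
    and cover: "n \<ge> 1 \<Longrightarrow> range Inl \<subseteq> (\<Union>w\<in>{1..wbar}. S n w)"
    and A3: "assumption_A3 V4 S"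

begin

abbreviation I :: "('v, 'm) idx set" where "I \<equiv> UNIV <+> Ebar E"

text \<open>The function whose conjugate belongs to the dual variable \<open>\<alpha>\<close> at the given stage, as a function on
the product space.\<close>

definition stage_fun :: "nat \<Rightarrow> nat \<Rightarrow> ('v, 'm) idx \<Rightarrow> real^'m^'v \<Rightarrow> ereal" where
  "stage_fun n w = lift_fun (cur_fun V4 f (fm n w))"

definition conj_val :: "nat \<Rightarrow> nat \<Rightarrow> ('v, 'm) idx \<Rightarrow> real" where
  "conj_val n w \<alpha> = real_of_ereal (fenchel_conj (stage_fun n w \<alpha>) (z n w \<alpha>))"

definition x :: "nat \<Rightarrow> nat \<Rightarrow> real^'m^'v" where
  "x n w = xbar - (\<Sum>\<alpha>\<in>I. z n w \<alpha>)"

text \<open>The dual value as a real number; it agrees with the dual objective once all conjugate values are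
finite.\<close>

definition \<Phi> :: "nat \<Rightarrow> nat \<Rightarrow> real" where
  "\<Phi> n w = (\<Sum>\<alpha>\<in>I. conj_val n w \<alpha>) + 1/2 * (norm (x n w))\<^sup>2"

lemma init_minorant: "i \<in> V4 \<Longrightarrow> convex_on UNIV (fm 1 0 i) \<and> (\<forall>x. ereal (fm 1 0 i x) \<le> f i x)"
  using algorithm unfolding distributed_dykstra_def by blast

lemma cycle_start:
  assumes "n \<ge> 1"
  shows "connects E (Eb n)"
    and "a \<in> Ebar E \<Longrightarrow> a \<notin> Eb n \<Longrightarrow> z n 0 (Inr a) = 0"
    and "a \<in> Ebar E \<Longrightarrow> z n 0 (Inr a) \<in> orthogonal_comp (Hsub a)"
    and "vH E (z (Suc n) 0) = vH E (z n wbar)"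
    and "z (Suc n) 0 (Inl i) = z n wbar (Inl i)"
    and "i \<in> V4 \<Longrightarrow> fm (Suc n) 0 i = fm n wbar i"
  using algorithm assms unfolding distributed_dykstra_def by blast+

lemma step:
  assumes "n \<ge> 1" "w < wbar"
  shows S_subset: "S n (Suc w) \<subseteq> UNIV <+> Eb n"
    and unchanged: "\<alpha> \<in> I \<Longrightarrow> \<alpha> \<notin> S n (Suc w) \<Longrightarrow> z n (Suc w) \<alpha> = z n w \<alpha>"
    and subgradient: "S n (Suc w) \<subseteq> Inl ` V4 \<Longrightarrow>
      subgradient_step E f V4 xbar (S n (Suc w)) (fm n w) (z n w) (fm n (Suc w)) (z n (Suc w))"
    and proximal: "\<not> S n (Suc w) \<subseteq> Inl ` V4 \<Longrightarrow>
      proximal_step E f V4 xbar (S n (Suc w)) (fm n w) (z n w) (fm n (Suc w)) (z n (Suc w))"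
proof -
  have "Suc w \<in> {1..wbar}" using assms by simp
  hence *: "S n (Suc w) \<subseteq> UNIV <+> Eb n \<and>
        (if S n (Suc w) \<subseteq> Inl ` V4
         then subgradient_step E f V4 xbar (S n (Suc w)) (fm n (Suc w-1)) (z n (Suc w-1)) (fm n (Suc w)) (z n (Suc w))
         else proximal_step E f V4 xbar (S n (Suc w)) (fm n (Suc w-1)) (z n (Suc w-1)) (fm n (Suc w)) (z n (Suc w))) \<and>
        (\<forall>\<alpha> \<in> UNIV <+> Ebar E. \<alpha> \<notin> S n (Suc w) \<longrightarrow> z n (Suc w) \<alpha> = z n (Suc w-1) \<alpha>)"
    using algorithm assms(1) unfolding distributed_dykstra_def by blast
  show "S n (Suc w) \<subseteq> UNIV <+> Eb n" using * by blast
  show "z n (Suc w) \<alpha> = z n w \<alpha>" if "\<alpha> \<in> I" "\<alpha> \<notin> S n (Suc w)" using * that by simp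
  show "subgradient_step E f V4 xbar (S n (Suc w)) (fm n w) (z n w) (fm n (Suc w)) (z n (Suc w))"
    if "S n (Suc w) \<subseteq> Inl ` V4" using * that by simp
  show "proximal_step E f V4 xbar (S n (Suc w)) (fm n w) (z n w) (fm n (Suc w)) (z n (Suc w))"
    if "\<not> S n (Suc w) \<subseteq> Inl ` V4" using * that by simp
qed

lemma Eb_subset: "n \<ge> 1 \<Longrightarrow> Eb n \<subseteq> Ebar E"
  by (auto simp: Eb)

lemma S_subset_I: "n \<ge> 1 \<Longrightarrow> w < wbar \<Longrightarrow> S n (Suc w) \<subseteq> I"
  using S_subset[of n w] Eb_subset[of n] by blast

lemma finite_I: "finite I" by simp

lemma mem_I [simp]: "Inl i \<in> I" "Inr a \<in> I \<longleftrightarrow> a \<in> Ebar E" by auto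

lemma subgradient_stepD:
  assumes "n \<ge> 1" "w < wbar" "S n (Suc w) \<subseteq> Inl ` V4"
  shows "Inl i \<in> S n (Suc w) \<Longrightarrow>
      subgradient_update (f i) (fm n w i) ((xbar - vH E (z n w)) $ i) ((xbar - vH E (z n w) - z n w (Inl i)) $ i)
          (fm n (Suc w) i) (z n (Suc w) (Inl i) $ i)"
    and "Inl i \<in> S n (Suc w) \<Longrightarrow> j \<noteq> i \<Longrightarrow> z n (Suc w) (Inl i) $ j = 0"
    and "i \<in> V4 \<Longrightarrow> Inl i \<notin> S n (Suc w) \<Longrightarrow> fm n (Suc w) i = fm n w i"
  using subgradient[OF assms] unfolding subgradient_step_def by blast+

lemma proximal_stepD:
  assumes "n \<ge> 1" "w < wbar" "\<not> S n (Suc w) \<subseteq> Inl ` V4"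
  shows "i \<in> V4 \<Longrightarrow> fm n (Suc w) i = fm n w i" "stage_fun n (Suc w) = stage_fun n w"
    and "is_arg_min (\<lambda>\<xi>. ereal (1/2 * (norm (xbar - (\<Sum>\<alpha>\<in>I - S n (Suc w). z n w \<alpha>) - (\<Sum>\<alpha>\<in>S n (Suc w). \<xi> \<alpha>)))\<^sup>2)
         + (\<Sum>\<alpha>\<in>S n (Suc w). fenchel_conj (stage_fun n (Suc w) \<alpha>) (\<xi> \<alpha>))) (\<lambda>_. True) (z n (Suc w))"
proof -
  show eq: "fm n (Suc w) i = fm n w i" if "i \<in> V4" for i
    using proximal[OF assms] that by (simp add: proximal_step_def)
  have "cur_fun V4 f (fm n (Suc w)) = cur_fun V4 f (fm n w)"
    by (rule ext) (simp add: cur_fun_def eq)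
  thus "stage_fun n (Suc w) = stage_fun n w" by (simp add: stage_fun_def)
  show "is_arg_min (\<lambda>\<xi>. ereal (1/2 * (norm (xbar - (\<Sum>\<alpha>\<in>I - S n (Suc w). z n w \<alpha>) - (\<Sum>\<alpha>\<in>S n (Suc w). \<xi> \<alpha>)))\<^sup>2)
         + (\<Sum>\<alpha>\<in>S n (Suc w). fenchel_conj (stage_fun n (Suc w) \<alpha>) (\<xi> \<alpha>))) (\<lambda>_. True) (z n (Suc w))"
    using proximal[OF assms] unfolding proximal_step_def stage_fun_def by blast
qed

lemma stage_fun_unchanged:
  assumes "n \<ge> 1" "w < wbar" "\<alpha> \<notin> S n (Suc w)"
  shows "stage_fun n (Suc w) \<alpha> = stage_fun n w \<alpha>"
proof (cases "S n (Suc w) \<subseteq> Inl ` V4")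
  case True
  thus ?thesis using subgradient_stepD(3)[OF assms(1,2) True] assms(3)
    by (cases \<alpha>) (auto simp: stage_fun_def cur_fun_def)
qed (use proximal_stepD(2) assms in auto)

lemma stage_fun_next_cycle:
  assumes "n \<ge> 1" shows "stage_fun (Suc n) 0 = stage_fun n wbar"
proof -
  have "cur_fun V4 f (fm (Suc n) 0) = cur_fun V4 f (fm n wbar)"
    using cycle_start(6)[OF assms] by (intro ext) (simp add: cur_fun_def)
  thus ?thesis by (simp add: stage_fun_def)
qed

text \<open>Convexity belongs to the invariant because the lower bound survives a subgradient step only through
the optimality condition of its proximal subproblem.\<close>

lemma minorant:
  assumes "n \<ge> 1" "w \<le> wbar" "i \<in> V4"
  shows "convex_on UNIV (fm n w i) \<and> (\<forall>x. ereal (fm n w i x) \<le> f i x)"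
proof -
  let ?P = "\<lambda>m. convex_on UNIV m \<and> (\<forall>x. ereal (m x) \<le> f i x)"
  have within: "?P (fm n w i)" if "n \<ge> 1" "?P (fm n 0 i)" "w \<le> wbar" for n w
    using that(3)
  proof (induction w)
    case (Suc w)
    hence w: "w < wbar" and IH: "?P (fm n w i)" by auto
    show ?case
    proof (cases "S n (Suc w) \<subseteq> Inl ` V4 \<and> Inl i \<in> S n (Suc w)")
      case True
      note upd = subgradient_stepD(1)[OF that(1) w conjunct1[OF True] conjunct2[OF True]]
      show ?thesis
        using affine_with_slope_convex[OF subgradient_update_affine[OF upd]]
          subgradient_update_minorant[OF upd] IH by blast
    next
      case False
      hence "fm n (Suc w) i = fm n w i"
        using subgradient_stepD(3)[OF that(1) w] proximal_stepD(1)[OF that(1) w] assms(3) by blast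
      thus ?thesis using IH by simp
    qed
  qed (use that in auto)
  have "?P (fm n 0 i)" using assms(1)
  proof (induction n rule: nat_induct_at_least)
    case base thus ?case using init_minorant assms(3) by auto
  next
    case (Suc n)
    thus ?case using within[of n wbar] cycle_start(6)[of n i] assms(3) by simp
  qed
  thus ?thesis using within assms by blast
qed

lemma cur_closed_convex:
  assumes "n \<ge> 1" "w \<le> wbar"
  shows "closed_convex_fun (cur_fun V4 f (fm n w) i)"
  using closed_convex_fun_real minorant[OF assms] f_closed_convex by (auto simp: cur_fun_def)

lemma cur_le_f:
  assumes "n \<ge> 1" "w \<le> wbar"
  shows "cur_fun V4 f (fm n w) i y \<le> f i y"
  using minorant[OF assms] by (auto simp: cur_fun_def)

lemma f_dom: "\<exists>y. f i y \<noteq> \<infinity>"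
proof -
  obtain y where "primal_obj E f xbar y < \<infinity>" using feasible by (auto simp: primal_feasible_def)
  hence "(\<Sum>\<alpha>\<in>I. lift_fun f \<alpha> y) \<noteq> \<infinity>" by (auto simp: primal_obj_def)
  hence "lift_fun f (Inl i) y \<noteq> \<infinity>" using finite_I by (subst (asm) sum_Pinfty) blast
  thus ?thesis by auto
qed

lemma cur_dom:
  assumes "n \<ge> 1" "w \<le> wbar"
  shows "\<exists>y. cur_fun V4 f (fm n w) i y \<noteq> \<infinity>"
  using f_dom[of i] cur_le_f[OF assms, of i] by (metis ereal_infty_less_eq(1))

lemma stage_fun_dom:
  assumes "n \<ge> 1" "w \<le> wbar"
  shows "\<exists>y. stage_fun n w \<alpha> y \<noteq> \<infinity>"
proof (cases \<alpha>)
  case (Inl i)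
  obtain y where y: "cur_fun V4 f (fm n w) i y \<noteq> \<infinity>" using cur_dom[OF assms] by blast
  hence "stage_fun n w \<alpha> (\<chi> _. y) \<noteq> \<infinity>" by (simp add: stage_fun_def Inl)
  thus ?thesis by blast
next
  case (Inr a)
  hence "stage_fun n w \<alpha> 0 \<noteq> \<infinity>"
    using subspace_0[OF subspace_Hsub, of a] by (simp add: stage_fun_def conv_indicator_def)
  thus ?thesis by blast
qed

lemma stage_fun_conj_proper:
  assumes "n \<ge> 1" "w \<le> wbar"
  shows "\<exists>y A. fenchel_conj (stage_fun n w \<alpha>) y \<le> ereal A"
proof (cases \<alpha>)
  case (Inl i)
  obtain y where "cur_fun V4 f (fm n w) i y \<noteq> \<infinity>" using cur_dom[OF assms] by blast
  thus ?thesis using lifted_conj_proper[of "cur_fun V4 f (fm n w)" i, OF cur_closed_convex[OF assms]]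
    by (simp only: Inl stage_fun_def)
next
  case (Inr a)
  have "0 \<in> orthogonal_comp (Hsub a)" by (simp add: orthogonal_comp_def orthogonal_clauses)
  from conj_subspace_indicator[OF subspace_Hsub this]
  have "fenchel_conj (stage_fun n w \<alpha>) 0 \<le> ereal 0" by (simp add: stage_fun_def Inr zero_ereal_def)
  thus ?thesis by blast
qed

lemma x_after_step:
  assumes "n \<ge> 1" "w < wbar"
  shows "x n (Suc w) = xbar - (\<Sum>\<alpha>\<in>I - S n (Suc w). z n w \<alpha>) - (\<Sum>\<alpha>\<in>S n (Suc w). z n (Suc w) \<alpha>)"
proof -
  have "(\<Sum>\<alpha>\<in>I. z n (Suc w) \<alpha>)
      = (\<Sum>\<alpha>\<in>I - S n (Suc w). z n (Suc w) \<alpha>) + (\<Sum>\<alpha>\<in>S n (Suc w). z n (Suc w) \<alpha>)"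
    by (rule sum.subset_diff[OF S_subset_I[OF assms] finite_I])
  also have "(\<Sum>\<alpha>\<in>I - S n (Suc w). z n (Suc w) \<alpha>) = (\<Sum>\<alpha>\<in>I - S n (Suc w). z n w \<alpha>)"
    using unchanged[OF assms] by (intro sum.cong) auto
  finally show ?thesis by (simp add: x_def algebra_simps)
qed

lemma proximal_optimality:
  assumes n: "n \<ge> 1" "w < wbar" "\<not> S n (Suc w) \<subseteq> Inl ` V4" and \<alpha>: "\<alpha> \<in> S n (Suc w)"
  shows "fenchel_conj (stage_fun n (Suc w) \<alpha>) (z n (Suc w) \<alpha>) = ereal (conj_val n (Suc w) \<alpha>)"
    and "fenchel_conj (stage_fun n (Suc w) \<alpha>) y \<le> ereal A \<Longrightarrow>
           conj_val n (Suc w) \<alpha> + x n (Suc w) \<bullet> (y - z n (Suc w) \<alpha>) \<le> A"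
proof -
  have w: "Suc w \<le> wbar" using n by simp
  have "finite (S n (Suc w))" using S_subset_I[OF n(1,2)] finite_I by (rule finite_subset)
  from block_minimizer_subgradient[OF this \<alpha> proximal_stepD(3)[OF n] stage_fun_dom[OF n(1) w] stage_fun_conj_proper[OF n(1) w]]
  obtain v where "fenchel_conj (stage_fun n (Suc w) \<alpha>) (z n (Suc w) \<alpha>) = ereal v"
    "\<forall>y A. fenchel_conj (stage_fun n (Suc w) \<alpha>) y \<le> ereal A \<longrightarrow> v + x n (Suc w) \<bullet> (y - z n (Suc w) \<alpha>) \<le> A"
    by (auto simp: x_after_step[OF n(1,2)])
  moreover from this(1) have "v = conj_val n (Suc w) \<alpha>" by (simp add: conj_val_def)
  ultimately show "fenchel_conj (stage_fun n (Suc w) \<alpha>) (z n (Suc w) \<alpha>) = ereal (conj_val n (Suc w) \<alpha>)"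
    and "fenchel_conj (stage_fun n (Suc w) \<alpha>) y \<le> ereal A \<Longrightarrow>
           conj_val n (Suc w) \<alpha> + x n (Suc w) \<bullet> (y - z n (Suc w) \<alpha>) \<le> A"
    by auto
qed

lemma subgradient_finite:
  assumes n: "n \<ge> 1" "w < wbar" "S n (Suc w) \<subseteq> Inl ` V4" and i: "Inl i \<in> S n (Suc w)"
  shows "affine_with_slope (fm n (Suc w) i) (z n (Suc w) (Inl i) $ i)"
    and "fenchel_conj (stage_fun n (Suc w) (Inl i)) (z n (Suc w) (Inl i)) = ereal (- fm n (Suc w) i 0)"
proof -
  have "i \<in> V4" using n(3) i by auto
  show aff: "affine_with_slope (fm n (Suc w) i) (z n (Suc w) (Inl i) $ i)"
    using subgradient_update_affine[OF subgradient_stepD(1)[OF n i]] .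
  show "fenchel_conj (stage_fun n (Suc w) (Inl i)) (z n (Suc w) (Inl i)) = ereal (- fm n (Suc w) i 0)"
    unfolding stage_fun_def
    by (rule lifted_conj_affine[OF subgradient_stepD(2)[OF n i] aff])
      (use \<open>i \<in> V4\<close> in \<open>auto simp: cur_fun_def\<close>)
qed

lemma edge_orthogonal:
  assumes "n \<ge> 1" "w \<le> wbar" "a \<in> Ebar E"
  shows "z n w (Inr a) \<in> orthogonal_comp (Hsub a)"
  using assms(2)
proof (induction w)
  case 0 thus ?case using cycle_start(3) assms by blast
next
  case (Suc w)
  hence w: "w < wbar" and IH: "z n w (Inr a) \<in> orthogonal_comp (Hsub a)" by auto
  show ?case
  proof (cases "Inr a \<in> S n (Suc w)")
    case True
    hence "\<not> S n (Suc w) \<subseteq> Inl ` V4" by auto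
    from proximal_optimality(1)[OF assms(1) w this True]
    have "fenchel_conj (conv_indicator (Hsub a)) (z n (Suc w) (Inr a)) \<le> ereal (conj_val n (Suc w) (Inr a))"
      by (simp add: stage_fun_def)
    thus ?thesis by (rule conj_subspace_indicator_finite[OF subspace_Hsub])
  next
    case False
    thus ?thesis using unchanged[OF assms(1) w _ False] assms(3) IH by simp
  qed
qed

lemma edge_conj:
  assumes "n \<ge> 1" "w \<le> wbar" "a \<in> Ebar E"
  shows "fenchel_conj (stage_fun n w (Inr a)) (z n w (Inr a)) = 0" "conj_val n w (Inr a) = 0"
  using conj_subspace_indicator[OF subspace_Hsub edge_orthogonal[OF assms]]
  by (simp_all add: stage_fun_def conj_val_def)

text \<open>A block minimization and a subgradient step both leave finite conjugate values on the indices they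
touch, and an untouched index keeps both its variable and its function.\<close>

lemma finite_if_updated:
  assumes "n \<ge> 1" "w \<le> wbar" "\<alpha> \<in> I"
    and "\<bar>fenchel_conj (stage_fun n 0 \<alpha>) (z n 0 \<alpha>)\<bar> \<noteq> \<infinity> \<or> (\<exists>w'\<in>{1..w}. \<alpha> \<in> S n w')"
  shows "\<bar>fenchel_conj (stage_fun n w \<alpha>) (z n w \<alpha>)\<bar> \<noteq> \<infinity>"
  using assms(2,4)
proof (induction w)
  case (Suc w)
  hence w: "w < wbar" by simp
  show ?case
  proof (cases "\<alpha> \<in> S n (Suc w)")
    case True
    show ?thesis
    proof (cases "S n (Suc w) \<subseteq> Inl ` V4")
      case sub: True
      then obtain i where "\<alpha> = Inl i" using True by auto
      thus ?thesis using subgradient_finite(2)[OF assms(1) w sub] True by simp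
    next
      case False
      thus ?thesis using proximal_optimality(1)[OF assms(1) w False True] by simp
    qed
  next
    case False
    have "w' \<in> {1..w}" if "w' \<in> {1..Suc w}" "\<alpha> \<in> S n w'" for w'
      using that False by (cases "w' = Suc w") auto
    hence "\<bar>fenchel_conj (stage_fun n w \<alpha>) (z n w \<alpha>)\<bar> \<noteq> \<infinity>" using Suc.IH Suc.prems w by (meson less_imp_le)
    thus ?thesis
      using unchanged[OF assms(1) w assms(3) False] stage_fun_unchanged[OF assms(1) w False] by simp
  qed
qed auto

lemma conj_finite:
  assumes "n \<ge> 2" "w \<le> wbar" "\<alpha> \<in> I"
  shows "fenchel_conj (stage_fun n w \<alpha>) (z n w \<alpha>) = ereal (conj_val n w \<alpha>)"
proof (cases \<alpha>)
  case (Inr a)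
  thus ?thesis using edge_conj[of n w a] assms by (auto simp: zero_ereal_def)
next
  case (Inl i)
  define n' where "n' = n - 1"
  have n': "n = Suc n'" "n' \<ge> 1" using assms(1) by (auto simp: n'_def)
  have "\<exists>w'\<in>{1..wbar}. \<alpha> \<in> S n' w'" using cover[OF n'(2)] Inl by blast
  hence "\<bar>fenchel_conj (stage_fun n' wbar \<alpha>) (z n' wbar \<alpha>)\<bar> \<noteq> \<infinity>"
    by (intro finite_if_updated[OF n'(2) order_refl assms(3)] disjI2)
  hence "\<bar>fenchel_conj (stage_fun n 0 \<alpha>) (z n 0 \<alpha>)\<bar> \<noteq> \<infinity>"
    using stage_fun_next_cycle[OF n'(2)] cycle_start(5)[OF n'(2)] by (simp add: n'(1) Inl)
  thus ?thesis using finite_if_updated[of n w \<alpha>] assms by (simp add: conj_val_def ereal_real)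
qed

lemma vertex_supported:
  assumes "n \<ge> 2" "w \<le> wbar" "j \<noteq> i"
  shows "z n w (Inl i) $ j = 0"
proof -
  obtain y where "cur_fun V4 f (fm n w) i y \<noteq> \<infinity>" using cur_dom[of n w i] assms by auto
  moreover have "fenchel_conj (lift_fun (cur_fun V4 f (fm n w)) (Inl i)) (z n w (Inl i))
      \<le> ereal (conj_val n w (Inl i))"
    using conj_finite[OF assms(1,2), of "Inl i"] by (simp only: stage_fun_def) auto
  ultimately show ?thesis using lifted_conj_support assms(3) by blast
qed

text \<open>Every cycle after the first opens with a subgradient step on all of \<open>V4\<close>, which makes the minorants
affine; later subgradient steps keep the slope equal to the dual variable by construction, and block
minimizations because the conjugate is finite only there.\<close>

lemma minorant_affine_in_cycle:
  assumes "n \<ge> 2" "1 \<le> w" "w \<le> wbar" "i \<in> V4"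
  shows "affine_with_slope (fm n w i) (z n w (Inl i) $ i)"
  using assms(2,3)
proof (induction w rule: nat_induct_at_least)
  case base
  have "S n 1 = Inl ` V4" using A3 assms by (auto simp: assumption_A3_def)
  thus ?case using subgradient_finite(1)[of n 0 i] assms wbar by simp
next
  case (Suc w)
  hence w: "w < wbar" and IH: "affine_with_slope (fm n w i) (z n w (Inl i) $ i)" by auto
  have n: "n \<ge> 1" using assms by simp
  show ?case
  proof (cases "S n (Suc w) \<subseteq> Inl ` V4")
    case sub: True
    show ?thesis
    proof (cases "Inl i \<in> S n (Suc w)")
      case True thus ?thesis using subgradient_finite(1)[OF n w sub] by blast
    next
      case False
      thus ?thesis using subgradient_stepD(3)[OF n w sub assms(4) False] IH unchanged[OF n w _ False] by simp
    qed
  next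
    case False
    have fm: "fm n (Suc w) i = fm n w i" using proximal_stepD(1)[OF n w False assms(4)] .
    have "fenchel_conj (lift_fun (cur_fun V4 f (fm n (Suc w))) (Inl i)) (z n (Suc w) (Inl i))
        \<le> ereal (conj_val n (Suc w) (Inl i))"
      using conj_finite[OF assms(1), of "Suc w" "Inl i"] w by (simp only: stage_fun_def) auto
    hence "z n (Suc w) (Inl i) $ i = z n w (Inl i) $ i"
      by (rule lifted_conj_affine_slope[OF _ IH]) (simp add: cur_fun_def assms(4) fm)
    thus ?thesis using IH fm by simp
  qed
qed

lemma minorant_affine:
  assumes "n \<ge> 3" "w \<le> wbar" "i \<in> V4"
  shows "affine_with_slope (fm n w i) (z n w (Inl i) $ i)"
proof (cases "w = 0")
  case True
  define n' where "n' = n - 1"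
  have n': "n = Suc n'" "n' \<ge> 2" using assms(1) by (auto simp: n'_def)
  hence "fm n 0 i = fm n' wbar i" "z n 0 (Inl i) = z n' wbar (Inl i)"
    using cycle_start(5,6)[of n' i] assms(3) by auto
  thus ?thesis using minorant_affine_in_cycle[of n' wbar i] n' wbar assms True by simp
qed (use minorant_affine_in_cycle[of n w i] assms in auto)

lemma minorant_conj_val:
  assumes "n \<ge> 3" "w \<le> wbar" "i \<in> V4"
  shows "conj_val n w (Inl i) = - fm n w i 0"
  unfolding conj_val_def stage_fun_def
  using lifted_conj_affine[of i "z n w (Inl i)", OF vertex_supported minorant_affine[OF assms]] assms
  by (simp add: cur_fun_def)

section \<open>Descent of the dual value\<close>

lemma x_component:
  assumes "n \<ge> 2" "w \<le> wbar"
  shows "x n w $ i = (xbar - vH E (z n w) - z n w (Inl i)) $ i"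
proof -
  have "(\<Sum>j\<in>UNIV. z n w (Inl j) $ i) = (\<Sum>j\<in>UNIV. if j = i then z n w (Inl i) $ i else 0)"
    using vertex_supported[OF assms] by (intro sum.cong) auto
  thus ?thesis by (simp add: x_def sum_vertices_edges vH_def)
qed

lemma x_next_cycle: "n \<ge> 1 \<Longrightarrow> x (Suc n) 0 = x n wbar"
  using cycle_start(4,5)[of n] by (simp add: x_def sum_vertices_edges vH_def)

text \<open>Given the primal point, the dual value splits over the vertices, since the edge variables contribute
no conjugate value.\<close>

lemma \<Phi>_vertices:
  assumes "n \<ge> 1" "w \<le> wbar"
  shows "\<Phi> n w = (\<Sum>i\<in>UNIV. conj_val n w (Inl i) + 1/2 * (norm (x n w $ i))\<^sup>2)"
proof -
  have "(\<Sum>a\<in>Ebar E. conj_val n w (Inr a)) = 0" using edge_conj(2)[OF assms] by (intro sum.neutral) blast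
  hence "\<Phi> n w = (\<Sum>i\<in>UNIV. conj_val n w (Inl i)) + 1/2 * (norm (x n w))\<^sup>2"
    by (simp add: \<Phi>_def sum_vertices_edges)
  thus ?thesis unfolding half_norm_sq_vec by (simp add: sum.distrib)
qed

lemma \<Phi>_next_cycle: "n \<ge> 1 \<Longrightarrow> \<Phi> (Suc n) 0 = \<Phi> n wbar"
  using \<Phi>_vertices[of "Suc n" 0] \<Phi>_vertices[of n wbar] x_next_cycle[of n]
  by (simp add: conj_val_def stage_fun_next_cycle cycle_start(5))

text \<open>The subgradient inequalities at the old variables, added to the exact expansion of the quadratic
term around the new primal point.\<close>

lemma proximal_descent:
  assumes n: "n \<ge> 2" "w < wbar" "\<not> S n (Suc w) \<subseteq> Inl ` V4"
  shows "1/2 * (norm (x n w - x n (Suc w)))\<^sup>2 \<le> \<Phi> n w - \<Phi> n (Suc w)"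
proof -
  let ?S = "S n (Suc w)" and ?y = "x n (Suc w)"
  have n1: "n \<ge> 1" using n by simp
  have le: "conj_val n (Suc w) \<alpha> + ?y \<bullet> (z n w \<alpha> - z n (Suc w) \<alpha>) \<le> conj_val n w \<alpha>" if "\<alpha> \<in> I" for \<alpha>
  proof (cases "\<alpha> \<in> ?S")
    case True
    have "fenchel_conj (stage_fun n (Suc w) \<alpha>) (z n w \<alpha>) \<le> ereal (conj_val n w \<alpha>)"
      using conj_finite[OF n(1) less_imp_le[OF n(2)] that] by (simp add: proximal_stepD(2)[OF n1 n(2,3)])
    thus ?thesis by (rule proximal_optimality(2)[OF n1 n(2,3) True])
  next
    case False
    thus ?thesis
      using unchanged[OF n1 n(2) that False] by (simp add: conj_val_def proximal_stepD(2)[OF n1 n(2,3)])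
  qed
  have "(\<Sum>\<alpha>\<in>I. conj_val n (Suc w) \<alpha> + ?y \<bullet> (z n w \<alpha> - z n (Suc w) \<alpha>)) \<le> (\<Sum>\<alpha>\<in>I. conj_val n w \<alpha>)"
    by (intro sum_mono le)
  moreover have "(\<Sum>\<alpha>\<in>I. ?y \<bullet> (z n w \<alpha> - z n (Suc w) \<alpha>)) = ?y \<bullet> (?y - x n w)"
    by (simp add: inner_sum_right[symmetric] sum_subtractf x_def)
  moreover have "1/2 * (norm (x n w - ?y))\<^sup>2 = 1/2 * (norm (x n w))\<^sup>2 - 1/2 * (norm ?y)\<^sup>2 + ?y \<bullet> (?y - x n w)"
    by (simp add: power2_norm_eq_inner inner_diff_left inner_diff_right inner_commute algebra_simps)
  ultimately show ?thesis by (simp add: \<Phi>_def sum.distrib)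
qed

text \<open>A subgradient step leaves the edge variables alone, so it acts on each vertex separately, and the proximal
center minus the vertex variable is the primal component before and after the step.\<close>

lemma subgradient_vertex_descent:
  assumes n: "n \<ge> 3" "w < wbar" "S n (Suc w) \<subseteq> Inl ` V4"
  defines "D \<equiv> \<lambda>i. (conj_val n w (Inl i) + 1/2 * (norm (x n w $ i))\<^sup>2)
                  - (conj_val n (Suc w) (Inl i) + 1/2 * (norm (x n (Suc w) $ i))\<^sup>2)"
  shows "1/2 * (norm (x n w $ i - x n (Suc w) $ i))\<^sup>2 \<le> D i"
    and "Inl i \<in> S n (Suc w) \<Longrightarrow> \<exists>s\<in>subdifferential (f i) (x n w $ i). \<forall>t\<in>{0..1}.
      t * (real_of_ereal (f i (x n w $ i)) - fm n w i (x n w $ i))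
        - t\<^sup>2 / 2 * (norm (s - z n w (Inl i) $ i))\<^sup>2 \<le> D i"
proof -
  have n1: "n \<ge> 1" and n2: "n \<ge> 2" and w: "w \<le> wbar" "Suc w \<le> wbar" using n by auto
  have vH: "vH E (z n (Suc w)) = vH E (z n w)"
    unfolding vH_def
  proof (intro sum.cong refl)
    fix a :: "'v set \<times> 'm" assume a: "a \<in> Ebar E"
    have "Inr a \<notin> S n (Suc w)" using n(3) by auto
    thus "z n (Suc w) (Inr a) = z n w (Inr a)" using unchanged[OF n1 n(2)] a by simp
  qed
  define c where "c = (xbar - vH E (z n w)) $ i"
  have x: "x n w $ i = c - z n w (Inl i) $ i" "x n (Suc w) $ i = c - z n (Suc w) (Inl i) $ i"
    using x_component[OF n2 w(1)] x_component[OF n2 w(2)] by (auto simp: c_def vH)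
  have upd: "1/2 * (norm (x n w $ i - x n (Suc w) $ i))\<^sup>2 \<le> D i \<and>
     (\<exists>s\<in>subdifferential (f i) (x n w $ i). \<forall>t\<in>{0..1}.
      t * (real_of_ereal (f i (x n w $ i)) - fm n w i (x n w $ i))
        - t\<^sup>2 / 2 * (norm (s - z n w (Inl i) $ i))\<^sup>2 \<le> D i)" if i: "Inl i \<in> S n (Suc w)"
  proof -
    have V4: "i \<in> V4" using n(3) i by auto
    have u: "subgradient_update (f i) (fm n w i) c (x n w $ i) (fm n (Suc w) i) (z n (Suc w) (Inl i) $ i)"
      using subgradient_stepD(1)[OF n1 n(2,3) i] x(1) by (simp add: c_def)
    have D: "D i = (1/2 * (norm (x n w $ i))\<^sup>2 - fm n w i 0)
        - (1/2 * (norm (c - z n (Suc w) (Inl i) $ i))\<^sup>2 - fm n (Suc w) i 0)"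
      by (simp only: D_def x(2) minorant_conj_val[OF n(1) w(1) V4] minorant_conj_val[OF n(1) w(2) V4])
    show ?thesis
      using subgradient_update_descent[OF u minorant_affine[OF n(1) w(1) V4] x(1)] unfolding D x(2) ..
  qed
  show "1/2 * (norm (x n w $ i - x n (Suc w) $ i))\<^sup>2 \<le> D i"
  proof (cases "Inl i \<in> S n (Suc w)")
    case True thus ?thesis using upd by blast
  next
    case False
    hence "z n (Suc w) (Inl i) = z n w (Inl i)" "stage_fun n (Suc w) (Inl i) = stage_fun n w (Inl i)"
      using unchanged[OF n1 n(2)] stage_fun_unchanged[OF n1 n(2)] by auto
    thus ?thesis by (simp add: D_def conj_val_def x)
  qed
  show "Inl i \<in> S n (Suc w) \<Longrightarrow> \<exists>s\<in>subdifferential (f i) (x n w $ i). \<forall>t\<in>{0..1}.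
      t * (real_of_ereal (f i (x n w $ i)) - fm n w i (x n w $ i))
        - t\<^sup>2 / 2 * (norm (s - z n w (Inl i) $ i))\<^sup>2 \<le> D i"
    using upd by blast
qed

lemma descent:
  assumes n: "n \<ge> 3" "w < wbar"
  shows "1/2 * (norm (x n w - x n (Suc w)))\<^sup>2 \<le> \<Phi> n w - \<Phi> n (Suc w)"
proof (cases "S n (Suc w) \<subseteq> Inl ` V4")
  case True
  have "(\<Sum>i\<in>UNIV. 1/2 * (norm ((x n w - x n (Suc w)) $ i))\<^sup>2)
     \<le> (\<Sum>i\<in>UNIV. (conj_val n w (Inl i) + 1/2 * (norm (x n w $ i))\<^sup>2)
                  - (conj_val n (Suc w) (Inl i) + 1/2 * (norm (x n (Suc w) $ i))\<^sup>2))"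
    using subgradient_vertex_descent(1)[OF n True] by (intro sum_mono) simp
  thus ?thesis
    unfolding half_norm_sq_vec using n \<Phi>_vertices[of n w] \<Phi>_vertices[of n "Suc w"] by (simp add: sum_subtractf)
qed (use proximal_descent n in auto)

lemma \<Phi>_mono:
  assumes "n \<ge> 3" "w \<le> w'" "w' \<le> wbar"
  shows "\<Phi> n w' \<le> \<Phi> n w"
  using assms(2,3)
proof (induction w' rule: dec_induct)
  case (step w')
  have "0 \<le> 1/2 * (norm (x n w' - x n (Suc w')))\<^sup>2" by simp
  with descent[OF assms(1), of w'] step show ?case by linarith
qed simp

lemma \<Phi>_antimono_cycle: "n \<ge> 3 \<Longrightarrow> \<Phi> (Suc n) 0 \<le> \<Phi> n 0"
  using \<Phi>_mono[of n 0 wbar] \<Phi>_next_cycle[of n] by simp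

text \<open>All primal points of a cycle are close to the last one: each of the \<open>wbar\<close> steps is at most as long as
the total decrease in the cycle permits.\<close>

lemma x_diff_le:
  assumes n: "n \<ge> 3" and w: "w \<le> wbar"
  shows "norm (x n w - x n wbar) \<le> real wbar * sqrt (2 * (\<Phi> n 0 - \<Phi> n wbar))"
proof -
  define e where "e = sqrt (2 * (\<Phi> n 0 - \<Phi> n wbar))"
  have "e \<ge> 0" using \<Phi>_mono[OF n, of 0 wbar] by (simp add: e_def)
  have one: "norm (x n k - x n (Suc k)) \<le> e" if k: "k < wbar" for k
  proof -
    have "(norm (x n k - x n (Suc k)))\<^sup>2 \<le> 2 * (\<Phi> n 0 - \<Phi> n wbar)"
      using descent[OF n k] \<Phi>_mono[OF n, of 0 k] \<Phi>_mono[OF n, of "Suc k" wbar] k by simp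
    thus ?thesis unfolding e_def by (rule real_le_rsqrt)
  qed
  have "norm (x n w - x n k) \<le> real (k - w) * e" if "w \<le> k" "k \<le> wbar" for k
    using that
  proof (induction k rule: dec_induct)
    case (step k)
    have "norm (x n w - x n (Suc k)) \<le> norm (x n w - x n k) + norm (x n k - x n (Suc k))"
      using norm_triangle_ineq[of "x n w - x n k" "x n k - x n (Suc k)"] by simp
    also have "\<dots> \<le> real (k - w) * e + e" using step one[of k] by simp
    also have "\<dots> = real (Suc k - w) * e" using step by (simp add: Suc_diff_le algebra_simps)
    finally show ?case .
  qed simp
  from this[OF w order_refl] have "norm (x n w - x n wbar) \<le> real (wbar - w) * e" .
  also have "\<dots> \<le> real wbar * e" using \<open>e \<ge> 0\<close> by (intro mult_right_mono) auto
  finally show ?thesis by (simp add: e_def)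
qed

text \<open>The witness \<open>p\<close> is the last stage that updates \<open>\<alpha>\<close>: its optimality condition stays valid for the
unchanged variable, with the primal point of stage \<open>p\<close>.\<close>

lemma optimal_at_last_update:
  assumes "n \<ge> 1" "w \<le> wbar" "\<alpha> \<in> I" "\<alpha> \<notin> Inl ` V4"
    and "\<exists>w'\<in>{1..w}. \<alpha> \<in> S n w'"
  shows "\<exists>p\<le>w. \<forall>y A. fenchel_conj (lift_fun f \<alpha>) y \<le> ereal A \<longrightarrow>
           conj_val n w \<alpha> + x n p \<bullet> (y - z n w \<alpha>) \<le> A"
  using assms(2,5)
proof (induction w)
  case (Suc w)
  hence w: "w < wbar" by simp
  have stage_fun: "stage_fun n k \<alpha> = lift_fun f \<alpha>" for k
    using assms(4) by (cases \<alpha>) (auto simp: stage_fun_def cur_fun_def)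
  show ?case
  proof (cases "\<alpha> \<in> S n (Suc w)")
    case True
    hence "\<not> S n (Suc w) \<subseteq> Inl ` V4" using assms(4) by blast
    from proximal_optimality(2)[OF assms(1) w this True] show ?thesis
      by (intro exI[of _ "Suc w"]) (simp add: stage_fun)
  next
    case False
    have "\<exists>w'\<in>{1..w}. \<alpha> \<in> S n w'"
      using Suc.prems(2) False by (metis atLeastAtMost_iff le_Suc_eq)
    then obtain p where "p \<le> w" "\<forall>y A. fenchel_conj (lift_fun f \<alpha>) y \<le> ereal A \<longrightarrow>
           conj_val n w \<alpha> + x n p \<bullet> (y - z n w \<alpha>) \<le> A"
      using Suc.IH w by auto
    thus ?thesis
      using unchanged[OF assms(1) w assms(3) False]
      by (intro exI[of _ p]) (simp add: conj_val_def stage_fun)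
  qed
qed simp

end

section \<open>Distance to the optimal dual value\<close>

locale bounded_dykstra_run = dykstra_run E V4 f xbar Creg wbar Eb S fm z
  for E :: "'v::finite set set" and V4 and f :: "'v \<Rightarrow> real^'m::finite \<Rightarrow> ereal"
    and xbar Creg wbar Eb S fm z +
  fixes zstar :: "('v, 'm) idx \<Rightarrow> real^'m^'v"
  assumes Creg: "regularity_constant E TYPE('m) Creg"
    and zstar: "is_arg_min (dual_obj E f xbar) (\<lambda>_. True) zstar"
    and bounded_iterates: "\<alpha> \<in> I \<Longrightarrow> bounded {z n w \<alpha> | n w. n \<ge> 1 \<and> w \<le> wbar}"

begin

definition opt_conj :: "('v, 'm) idx \<Rightarrow> real" where
  "opt_conj \<alpha> = real_of_ereal (fenchel_conj (lift_fun f \<alpha>) (zstar \<alpha>))"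

definition opt_val :: real where
  "opt_val = (\<Sum>\<alpha>\<in>I. opt_conj \<alpha>) + 1/2 * (norm (xbar - (\<Sum>\<alpha>\<in>I. zstar \<alpha>)))\<^sup>2"

lemma dual_obj_cur:
  assumes "n \<ge> 2" "w \<le> wbar"
  shows "dual_obj E (cur_fun V4 f (fm n w)) xbar (z n w) = ereal (\<Phi> n w)"
  unfolding dual_obj_eq stage_fun_def[symmetric] using conj_finite[OF assms]
  by (simp add: \<Phi>_def x_def)

lemma dual_obj_zstar_le:
  assumes "n \<ge> 2" "w \<le> wbar"
  shows "dual_obj E f xbar zstar \<le> ereal (\<Phi> n w)"
proof -
  have n: "n \<ge> 1" using assms by simp
  have "dual_obj E f xbar zstar \<le> dual_obj E f xbar (z n w)"
    using zstar by (simp add: is_arg_min_linorder)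
  also have "\<dots> \<le> dual_obj E (cur_fun V4 f (fm n w)) xbar (z n w)"
    unfolding dual_obj_eq
  proof (intro add_right_mono sum_mono fenchel_conj_antimono)
    fix \<alpha> y show "lift_fun (cur_fun V4 f (fm n w)) \<alpha> y \<le> lift_fun f \<alpha> y"
      using cur_le_f[OF n assms(2)] by (cases \<alpha>) auto
  qed
  finally show ?thesis by (simp add: dual_obj_cur[OF assms])
qed

text \<open>The optimal value is below the value of an iterate of the second cycle, which is finite; this excludes
that the dual objective is identically infinite, where every point would be a minimizer.\<close>

lemma opt_conj_finite:
  assumes "\<alpha> \<in> I"
  shows "fenchel_conj (lift_fun f \<alpha>) (zstar \<alpha>) = ereal (opt_conj \<alpha>)"
proof -
  have "dual_obj E f xbar zstar < \<infinity>"
    using dual_obj_zstar_le[of 2 0] by (auto intro: le_less_trans)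
  hence "(\<Sum>\<alpha>\<in>I. fenchel_conj (lift_fun f \<alpha>) (zstar \<alpha>)) \<noteq> \<infinity>" by (auto simp: dual_obj_eq)
  hence "fenchel_conj (lift_fun f \<alpha>) (zstar \<alpha>) \<noteq> \<infinity>"
    using finite_I assms by (subst (asm) sum_Pinfty) blast
  moreover have "fenchel_conj (lift_fun f \<alpha>) (zstar \<alpha>) \<noteq> -\<infinity>"
  proof (cases \<alpha>)
    case (Inl i)
    obtain y where "f i y \<noteq> \<infinity>" using f_dom by blast
    thus ?thesis using fenchel_conj_gt_MInf[of "lift_fun f \<alpha>" "\<chi> _. y"] by (simp add: Inl)
  next
    case (Inr a)
    have "lift_fun f \<alpha> 0 \<noteq> \<infinity>"
      using subspace_0[OF subspace_Hsub, of a] by (simp add: Inr conv_indicator_def)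
    thus ?thesis by (rule fenchel_conj_gt_MInf)
  qed
  ultimately show ?thesis
    by (cases "fenchel_conj (lift_fun f \<alpha>) (zstar \<alpha>)") (auto simp: opt_conj_def)
qed

lemma dual_obj_zstar: "dual_obj E f xbar zstar = ereal opt_val"
  unfolding dual_obj_eq using opt_conj_finite by (simp add: opt_val_def)

lemma opt_val_le: "n \<ge> 2 \<Longrightarrow> w \<le> wbar \<Longrightarrow> opt_val \<le> \<Phi> n w"
  using dual_obj_zstar_le by (simp add: dual_obj_zstar)

lemma zstar_edge:
  assumes "a \<in> Ebar E"
  shows "zstar (Inr a) \<in> orthogonal_comp (Hsub a)" "opt_conj (Inr a) = 0"
proof -
  have *: "fenchel_conj (conv_indicator (Hsub a)) (zstar (Inr a)) = ereal (opt_conj (Inr a))"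
    using opt_conj_finite[of "Inr a"] assms by simp
  show o: "zstar (Inr a) \<in> orthogonal_comp (Hsub a)"
    by (rule conj_subspace_indicator_finite[OF subspace_Hsub]) (use * in auto)
  show "opt_conj (Inr a) = 0"
    using * conj_subspace_indicator[OF subspace_Hsub o] by simp
qed

lemma vH_zstar_orthogonal: "vH E zstar \<in> orthogonal_comp (Dsub E)"
  unfolding vH_def
proof (rule subspace_sum[OF subspace_orthogonal_comp])
  fix a :: "'v set \<times> 'm" assume a: "a \<in> Ebar E"
  hence "Dsub E \<subseteq> Hsub a" by (auto simp: Dsub_def)
  thus "zstar (Inr a) \<in> orthogonal_comp (Dsub E)"
    using zstar_edge(1)[OF a] by (auto simp: orthogonal_comp_def)
qed

text \<open>A dual optimizer adapted to cycle \<open>n\<close>: only the sum of the edge variables matters for the dual value,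
and that sum lies in the orthogonal complement of \<open>Dsub E\<close>, so it can be rewritten over the
connecting set of the cycle with norms bounded independently of \<open>n\<close>.\<close>

lemma redistributed_optimizer:
  assumes "n \<ge> 1"
  obtains y where "\<And>i. y (Inl i) = zstar (Inl i)" "(\<Sum>\<alpha>\<in>I. y \<alpha>) = (\<Sum>\<alpha>\<in>I. zstar \<alpha>)"
    "\<And>a. a \<in> Ebar E \<Longrightarrow> y (Inr a) \<in> orthogonal_comp (Hsub a)"
    "\<And>a. a \<in> Ebar E \<Longrightarrow> norm (y (Inr a)) \<le> Creg * norm (vH E zstar)"
    "\<And>a. a \<notin> Eb n \<Longrightarrow> y (Inr a) = 0"
proof -
  have C: "Creg > 0" using Creg by (simp add: regularity_constant_def)
  obtain u where u: "vH E zstar = (\<Sum>a\<in>Eb n. u a)"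
    "\<And>a. a \<in> Eb n \<Longrightarrow> u a \<in> orthogonal_comp (Hsub a) \<and> norm (u a) \<le> Creg * norm (vH E zstar)"
    using Creg vH_zstar_orthogonal cycle_start(1)[OF assms]
    unfolding regularity_constant_def by blast
  define y where "y \<alpha> = (case \<alpha> of Inl i \<Rightarrow> zstar (Inl i) | Inr a \<Rightarrow> if a \<in> Eb n then u a else 0)" for \<alpha>
  have "(\<Sum>a\<in>Ebar E. y (Inr a)) = (\<Sum>a\<in>Eb n. u a)"
    using Eb_subset[OF assms] by (simp add: y_def sum.If_cases Int_absorb1)
  hence "(\<Sum>\<alpha>\<in>I. y \<alpha>) = (\<Sum>\<alpha>\<in>I. zstar \<alpha>)"
    using u(1) by (simp add: sum_vertices_edges vH_def y_def)
  moreover have "y (Inr a) \<in> orthogonal_comp (Hsub a)" for a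
    using u(2) by (simp add: y_def orthogonal_comp_def orthogonal_clauses)
  moreover have "norm (y (Inr a)) \<le> Creg * norm (vH E zstar)" for a
    using u(2) C by (simp add: y_def)
  ultimately show ?thesis by (intro that[of y]) (auto simp: y_def)
qed

lemma iterates_bounded: "\<exists>R. \<forall>n\<ge>1. \<forall>w\<le>wbar. \<forall>\<alpha>\<in>I. norm (z n w \<alpha>) \<le> R"
proof -
  have "\<exists>b. \<forall>n\<ge>1. \<forall>w\<le>wbar. norm (z n w \<alpha>) \<le> b" if "\<alpha> \<in> I" for \<alpha>
    using bounded_iterates[OF that] unfolding bounded_iff by blast
  then obtain b where b: "\<And>\<alpha> n w. \<alpha> \<in> I \<Longrightarrow> n \<ge> 1 \<Longrightarrow> w \<le> wbar \<Longrightarrow> norm (z n w \<alpha>) \<le> b \<alpha>"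
    by metis
  have "norm (z n w \<alpha>) \<le> Max (b ` I)" if "\<alpha> \<in> I" "n \<ge> 1" "w \<le> wbar" for \<alpha> n w
    using b[OF that] Max_ge[of "b ` I" "b \<alpha>"] finite_I that(1) by (meson finite_imageI imageI order_trans)
  thus ?thesis by blast
qed

lemma x_bounded: "\<exists>R. \<forall>n\<ge>1. \<forall>w\<le>wbar. norm (x n w) \<le> R"
proof -
  obtain R where R: "\<And>n w \<alpha>. n \<ge> 1 \<Longrightarrow> w \<le> wbar \<Longrightarrow> \<alpha> \<in> I \<Longrightarrow> norm (z n w \<alpha>) \<le> R"
    using iterates_bounded by blast
  have "norm (x n w) \<le> norm xbar + (\<Sum>\<alpha>\<in>I. R)" if "n \<ge> 1" "w \<le> wbar" for n w
  proof -
    have "norm (x n w) \<le> norm xbar + norm (\<Sum>\<alpha>\<in>I. z n w \<alpha>)"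
      unfolding x_def by (rule norm_triangle_ineq4)
    also have "norm (\<Sum>\<alpha>\<in>I. z n w \<alpha>) \<le> (\<Sum>\<alpha>\<in>I. R)" using R[OF that] by (intro sum_norm_le)
    finally show ?thesis by simp
  qed
  thus ?thesis by blast
qed

definition gap :: "nat \<Rightarrow> nat \<Rightarrow> 'v \<Rightarrow> real" where
  "gap n w i = real_of_ereal (f i (x n w $ i)) - fm n w i (x n w $ i)"

lemma gap_next_cycle: "n \<ge> 1 \<Longrightarrow> i \<in> V4 \<Longrightarrow> gap (Suc n) 0 i = gap n wbar i"
  by (simp add: gap_def x_next_cycle cycle_start(6))

lemma f_real: "i \<in> V4 \<Longrightarrow> f i y = ereal (real_of_ereal (f i y))"
  using f_V4[of i y] f_closed_convex[of i] by (auto simp: closed_convex_fun_def ereal_real)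

text \<open>Fenchel inequality for the true function at the optimizer, Fenchel equality for the affine minorant
at the iterate, both at the final primal point of the cycle.\<close>

lemma vertex_gap_bound:
  assumes n: "n \<ge> 3" and i: "i \<in> V4" and y: "y (Inl i) = zstar (Inl i)"
  shows "conj_val n wbar (Inl i) - opt_conj (Inl i)
      \<le> x n wbar \<bullet> (z n wbar (Inl i) - y (Inl i)) + gap n wbar i"
proof -
  let ?q = "x n wbar"
  have "fenchel_conj (lift_fun f (Inl i)) (y (Inl i)) \<le> ereal (opt_conj (Inl i))"
    using opt_conj_finite[of "Inl i"] y by simp
  hence "ereal (y (Inl i) \<bullet> ?q - opt_conj (Inl i)) \<le> f i (?q $ i)"
    by (simp add: fenchel_conj_le_iff)
  hence 1: "y (Inl i) \<bullet> ?q - opt_conj (Inl i) \<le> real_of_ereal (f i (?q $ i))"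
    using f_real[OF i] by (metis ereal_less_eq(3))
  have "fm n wbar i (?q $ i) = fm n wbar i 0 + z n wbar (Inl i) $ i \<bullet> ?q $ i"
    using minorant_affine[OF n order_refl i] unfolding affine_with_slope_def by blast
  also have "z n wbar (Inl i) $ i \<bullet> ?q $ i = z n wbar (Inl i) \<bullet> ?q"
    using vertex_supported[of n wbar] n by (intro inner_supported[symmetric]) auto
  finally have "conj_val n wbar (Inl i) = z n wbar (Inl i) \<bullet> ?q - fm n wbar i (?q $ i)"
    using minorant_conj_val[OF n order_refl i] by simp
  with 1 show ?thesis by (simp add: gap_def inner_diff_right inner_commute)
qed

text \<open>Replacing the primal point of the last update by the final one costs the displacement of the primal
point times the distance between the dual variables.\<close>

lemma updated_gap_bound:
  assumes n: "n \<ge> 3" and \<alpha>: "\<alpha> \<in> I" "\<alpha> \<notin> Inl ` V4" and upd: "\<exists>w\<in>{1..wbar}. \<alpha> \<in> S n w"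
    and y: "fenchel_conj (lift_fun f \<alpha>) y \<le> ereal A" and R: "norm (z n wbar \<alpha> - y) \<le> R"
  shows "conj_val n wbar \<alpha> - A
      \<le> x n wbar \<bullet> (z n wbar \<alpha> - y) + real wbar * sqrt (2 * (\<Phi> n 0 - \<Phi> n wbar)) * R"
proof -
  obtain p where p: "p \<le> wbar" "conj_val n wbar \<alpha> + x n p \<bullet> (y - z n wbar \<alpha>) \<le> A"
    using optimal_at_last_update[of n wbar \<alpha>] n \<alpha> upd y by auto
  have "(x n p - x n wbar) \<bullet> (z n wbar \<alpha> - y) \<le> norm (x n p - x n wbar) * norm (z n wbar \<alpha> - y)"
    by (rule norm_cauchy_schwarz)
  also have "\<dots> \<le> (real wbar * sqrt (2 * (\<Phi> n 0 - \<Phi> n wbar))) * R"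
    using x_diff_le[OF n p(1)] R \<Phi>_mono[OF n, of 0 wbar] by (intro mult_mono) auto
  finally show ?thesis using p(2) by (simp add: inner_diff_left inner_diff_right)
qed

text \<open>The indices fall into three classes: vertices in \<open>V4\<close>, indices updated in the cycle, and edges
outside the connecting set, at which the iterate and the adapted optimizer both vanish. The linear
terms add up to \<open>x \<bullet> (xs - x)\<close>, where \<open>xs\<close> is the primal point of the optimizer, and this is
absorbed by the difference of the quadratic terms.\<close>

lemma cycle_gap_bound:
  "\<exists>C\<ge>0. \<forall>n\<ge>3. \<Phi> n wbar - opt_val \<le> C * sqrt (\<Phi> n 0 - \<Phi> n wbar) + (\<Sum>i\<in>V4. gap n wbar i)"
proof -
  obtain R0 where R0: "\<And>n w \<alpha>. n \<ge> 1 \<Longrightarrow> w \<le> wbar \<Longrightarrow> \<alpha> \<in> I \<Longrightarrow> norm (z n w \<alpha>) \<le> R0"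
    using iterates_bounded by blast
  define R where "R = R0 + ((\<Sum>i\<in>UNIV. norm (zstar (Inl i))) + Creg * norm (vH E zstar))"
  have C: "Creg > 0" using Creg by (simp add: regularity_constant_def)
  have "0 \<le> norm (z 1 0 (Inl undefined))" by simp
  also have "\<dots> \<le> R0" by (rule R0) auto
  finally have "R \<ge> 0" using C by (simp add: R_def sum_nonneg)
  define K where "K = real wbar * sqrt 2 * R"
  have K: "K \<ge> 0" using \<open>R \<ge> 0\<close> by (simp add: K_def)
  have "\<Phi> n wbar - opt_val \<le> (real (card I) * K) * sqrt (\<Phi> n 0 - \<Phi> n wbar) + (\<Sum>i\<in>V4. gap n wbar i)"
    if n: "n \<ge> 3" for n
  proof -
    have n1: "n \<ge> 1" using n by simp
    define d where "d = \<Phi> n 0 - \<Phi> n wbar"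
    have d: "d \<ge> 0" using \<Phi>_mono[OF n, of 0 wbar] by (simp add: d_def)
    obtain y where y: "\<And>i. y (Inl i) = zstar (Inl i)" "(\<Sum>\<alpha>\<in>I. y \<alpha>) = (\<Sum>\<alpha>\<in>I. zstar \<alpha>)"
      "\<And>a. a \<in> Ebar E \<Longrightarrow> y (Inr a) \<in> orthogonal_comp (Hsub a)"
      "\<And>a. a \<in> Ebar E \<Longrightarrow> norm (y (Inr a)) \<le> Creg * norm (vH E zstar)"
      "\<And>a. a \<notin> Eb n \<Longrightarrow> y (Inr a) = 0"
      using redistributed_optimizer[OF n1] by blast
    have y_norm: "norm (y \<alpha>) \<le> (\<Sum>i\<in>UNIV. norm (zstar (Inl i))) + Creg * norm (vH E zstar)"
      if "\<alpha> \<in> I" for \<alpha>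
    proof (cases \<alpha>)
      case (Inl i)
      have "norm (zstar (Inl i)) \<le> (\<Sum>i\<in>UNIV. norm (zstar (Inl i)))"
        by (rule member_le_sum) auto
      thus ?thesis using y(1) C Inl by (simp add: add_increasing2)
    next
      case (Inr a)
      have "0 \<le> (\<Sum>i\<in>UNIV. norm (zstar (Inl i)))" by (intro sum_nonneg) simp
      thus ?thesis using y(4)[of a] that Inr by simp
    qed
    have zy: "norm (z n wbar \<alpha> - y \<alpha>) \<le> R" if "\<alpha> \<in> I" for \<alpha>
      using norm_triangle_ineq4[of "z n wbar \<alpha>" "y \<alpha>"] R0[OF n1 order_refl that] y_norm[OF that]
      unfolding R_def by linarith
    have err: "real wbar * sqrt (2 * (\<Phi> n 0 - \<Phi> n wbar)) * R = K * sqrt d"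
      unfolding K_def d_def real_sqrt_mult by (simp only: ac_simps)
    define g where "g \<alpha> = (case \<alpha> of Inl i \<Rightarrow> if i \<in> V4 then gap n wbar i else 0 | Inr _ \<Rightarrow> 0)" for \<alpha> :: "('v, 'm) idx"
    have summand: "conj_val n wbar \<alpha> - opt_conj \<alpha> \<le> x n wbar \<bullet> (z n wbar \<alpha> - y \<alpha>) + K * sqrt d + g \<alpha>"
      if \<alpha>: "\<alpha> \<in> I" for \<alpha>
    proof (cases "\<alpha> \<in> Inl ` V4")
      case True
      then obtain i where i: "\<alpha> = Inl i" "i \<in> V4" by blast
      have "0 \<le> K * sqrt d" using K d by simp
      thus ?thesis using vertex_gap_bound[where y = y, OF n i(2) y(1)] i by (simp add: g_def)
    next
      case False
      hence g: "g \<alpha> = 0" by (auto simp: g_def split: sum.split)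
      have fy: "fenchel_conj (lift_fun f \<alpha>) (y \<alpha>) \<le> ereal (opt_conj \<alpha>)"
      proof (cases \<alpha>)
        case (Inl i) thus ?thesis using opt_conj_finite[of "Inl i"] y(1) by simp
      next
        case (Inr a)
        hence a: "a \<in> Ebar E" using \<alpha> by simp
        show ?thesis
          using conj_subspace_indicator[OF subspace_Hsub y(3)[OF a]] zstar_edge(2)[OF a]
          by (simp add: Inr zero_ereal_def)
      qed
      show ?thesis
      proof (cases "\<exists>w\<in>{1..wbar}. \<alpha> \<in> S n w")
        case True
        from updated_gap_bound[OF n \<alpha> False True fy zy[OF \<alpha>], unfolded err] show ?thesis by (simp add: g)
      next
        case no: False
        then obtain a where a: "\<alpha> = Inr a" using cover[OF n1] by (cases \<alpha>) blast+
        hence aE: "a \<in> Ebar E" and aEb: "a \<notin> Eb n" using \<alpha> no Eb[OF n1] by auto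
        \<comment> \<open>An edge that is never updated in the cycle lies outside \<open>Eb n\<close>, so it starts at zero and stays there.\<close>
        have "z n k \<alpha> = 0" if "k \<le> wbar" for k
          using that
        proof (induction k)
          case 0 thus ?case using cycle_start(2)[OF n1 aE aEb] a by simp
        next
          case (Suc k)
          thus ?case using unchanged[OF n1 _ \<alpha>, of k] no by force
        qed
        thus ?thesis using y(5)[OF aEb] edge_conj(2)[OF n1 order_refl aE] zstar_edge(2)[OF aE] a K d g
          by simp
      qed
    qed
    have "(\<Sum>\<alpha>\<in>I. conj_val n wbar \<alpha> - opt_conj \<alpha>)
        \<le> (\<Sum>\<alpha>\<in>I. x n wbar \<bullet> (z n wbar \<alpha> - y \<alpha>) + K * sqrt d + g \<alpha>)"
      by (intro sum_mono summand)
    also have "\<dots> = x n wbar \<bullet> ((\<Sum>\<alpha>\<in>I. z n wbar \<alpha>) - (\<Sum>\<alpha>\<in>I. zstar \<alpha>))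
        + real (card I) * K * sqrt d + (\<Sum>\<alpha>\<in>I. g \<alpha>)"
      by (simp add: sum.distrib inner_sum_right[symmetric] sum_subtractf y(2))
    also have "(\<Sum>\<alpha>\<in>I. g \<alpha>) = (\<Sum>i\<in>V4. gap n wbar i)"
      by (simp add: sum_vertices_edges g_def sum.If_cases)
    finally have main: "(\<Sum>\<alpha>\<in>I. conj_val n wbar \<alpha>) - (\<Sum>\<alpha>\<in>I. opt_conj \<alpha>)
        \<le> x n wbar \<bullet> ((\<Sum>\<alpha>\<in>I. z n wbar \<alpha>) - (\<Sum>\<alpha>\<in>I. zstar \<alpha>))
        + real (card I) * K * sqrt d + (\<Sum>i\<in>V4. gap n wbar i)" by (simp add: sum_subtractf)
    define xs where "xs = xbar - (\<Sum>\<alpha>\<in>I. zstar \<alpha>)"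
    have "(\<Sum>\<alpha>\<in>I. z n wbar \<alpha>) - (\<Sum>\<alpha>\<in>I. zstar \<alpha>) = xs - x n wbar" by (simp add: xs_def x_def)
    moreover have "1/2 * (norm (x n wbar))\<^sup>2 - 1/2 * (norm xs)\<^sup>2 + x n wbar \<bullet> (xs - x n wbar)
        = - (1/2 * (norm (x n wbar - xs))\<^sup>2)"
      by (simp add: power2_norm_eq_inner inner_diff_left inner_diff_right inner_commute algebra_simps)
    hence "1/2 * (norm (x n wbar))\<^sup>2 - 1/2 * (norm xs)\<^sup>2 + x n wbar \<bullet> (xs - x n wbar) \<le> 0" by simp
    ultimately show ?thesis using main unfolding \<Phi>_def opt_val_def xs_def[symmetric] d_def[symmetric]
      by (simp add: \<Phi>_def d_def)
  qed
  thus ?thesis using K by (intro exI[of _ "real (card I) * K"]) auto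
qed

text \<open>The first step of a cycle is a subgradient step on all of \<open>V4\<close>, taken at the primal point at which
the gap is measured. The chosen subgradients are bounded because the primal points are, and the
dual variables are bounded by assumption.\<close>

lemma minorant_gap_bound:
  "\<exists>C\<ge>0. \<forall>n\<ge>3. \<forall>i\<in>V4. gap n 0 i \<le> C * sqrt (\<Phi> n 0 - \<Phi> (Suc n) 0)"
proof -
  obtain R where R: "\<And>n w \<alpha>. n \<ge> 1 \<Longrightarrow> w \<le> wbar \<Longrightarrow> \<alpha> \<in> I \<Longrightarrow> norm (z n w \<alpha>) \<le> R"
    using iterates_bounded by blast
  obtain Rx where Rx: "\<And>n w. n \<ge> 1 \<Longrightarrow> w \<le> wbar \<Longrightarrow> norm (x n w) \<le> Rx"
    using x_bounded by blast
  have "\<exists>b. \<forall>q s. norm q \<le> Rx \<longrightarrow> s \<in> subdifferential (f i) q \<longrightarrow> norm s \<le> b" if "i \<in> V4" for i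
    using subdifferential_locally_bounded[OF f_closed_convex f_V4[OF that]] by blast
  then obtain b where b: "\<And>i q s. i \<in> V4 \<Longrightarrow> norm q \<le> Rx \<Longrightarrow> s \<in> subdifferential (f i) q \<Longrightarrow> norm s \<le> b i"
    by metis
  define B where "B = (\<Sum>i\<in>V4. \<bar>b i\<bar>) + R"
  \<comment> \<open>A bound on all later decreases; the summand 1 keeps it positive even at optimality.\<close>
  define M where "M = \<Phi> 3 0 - opt_val + 1"
  have M: "M > 0" using opt_val_le[of 3 0] by (simp add: M_def)
  have "gap n 0 i \<le> (sqrt M + B\<^sup>2 / (2 * sqrt M)) * sqrt (\<Phi> n 0 - \<Phi> (Suc n) 0)"
    if n: "n \<ge> 3" and i: "i \<in> V4" for n i
  proof -
    have n1: "n \<ge> 1" using n by simp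
    have Sn: "S n (Suc 0) = Inl ` V4" using A3 i n by (auto simp: assumption_A3_def)
    define D where "D i = (conj_val n 0 (Inl i) + 1/2 * (norm (x n 0 $ i))\<^sup>2)
                  - (conj_val n (Suc 0) (Inl i) + 1/2 * (norm (x n (Suc 0) $ i))\<^sup>2)" for i
    note desc = subgradient_vertex_descent[OF n wbar, unfolded Sn, OF order_refl, folded D_def]
    obtain s where s: "s \<in> subdifferential (f i) (x n 0 $ i)"
      "\<And>t. t \<in> {0..1} \<Longrightarrow> t * gap n 0 i - t\<^sup>2 / 2 * (norm (s - z n 0 (Inl i) $ i))\<^sup>2 \<le> D i"
      using desc(2)[OF imageI[OF i]] unfolding gap_def D_def by blast
    have D_nonneg: "D j \<ge> 0" for j
      using desc(1)[of j] by (rule order_trans[rotated]) simp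
    have "D i \<le> (\<Sum>j\<in>UNIV. D j)" using D_nonneg by (intro member_le_sum) auto
    also have "\<dots> = \<Phi> n 0 - \<Phi> n (Suc 0)"
      using \<Phi>_vertices[of n 0] \<Phi>_vertices[of n "Suc 0"] n1 wbar by (simp add: D_def sum_subtractf)
    also have "\<dots> \<le> \<Phi> n 0 - \<Phi> (Suc n) 0"
      using \<Phi>_mono[OF n, of "Suc 0" wbar] wbar \<Phi>_next_cycle[OF n1] by simp
    finally have D: "D i \<le> \<Phi> n 0 - \<Phi> (Suc n) 0" .
    have "\<Phi> n 0 \<le> \<Phi> 3 0" using n
    proof (induction n rule: nat_induct_at_least)
      case (Suc n) thus ?case using \<Phi>_antimono_cycle[of n] by simp
    qed simp
    hence DM: "\<Phi> n 0 - \<Phi> (Suc n) 0 \<le> M" using opt_val_le[of "Suc n" 0] n by (simp add: M_def)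
    have "norm (x n 0 $ i) \<le> Rx" using Rx[OF n1, of 0] Finite_Cartesian_Product.norm_nth_le[of "x n 0" i] by simp
    from b[OF i this s(1)] have "norm s \<le> b i" .
    also have "b i \<le> \<bar>b i\<bar>" by simp
    also have "\<dots> \<le> (\<Sum>i\<in>V4. \<bar>b i\<bar>)" using i by (intro member_le_sum) auto
    finally have "norm s \<le> (\<Sum>i\<in>V4. \<bar>b i\<bar>)" .
    moreover have "norm (z n 0 (Inl i) $ i) \<le> R"
      using R[OF n1, of 0 "Inl i"] Finite_Cartesian_Product.norm_nth_le[of "z n 0 (Inl i)" i] by simp
    ultimately have "norm (s - z n 0 (Inl i) $ i) \<le> B"
      using norm_triangle_ineq4[of s "z n 0 (Inl i) $ i"] unfolding B_def by linarith
    from gap_le_sqrt[OF order_trans[OF s(2) D] _ this _ DM M] D D_nonneg[of i] show ?thesis by simp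
  qed
  thus ?thesis using M by (intro exI[of _ "sqrt M + B\<^sup>2 / (2 * sqrt M)"]) auto
qed

text \<open>The end of cycle \<open>n\<close> is the start of cycle \<open>n + 1\<close>; bounding the losses there by square roots of the
decreases in the cycles \<open>n\<close> and \<open>n + 1\<close>, and those by the joint decrease, yields the recurrence.\<close>

lemma sublinear_convergence: "\<exists>A. \<forall>n\<ge>3. \<Phi> n 0 - opt_val \<le> A / real n"
proof -
  obtain C1 where C1: "C1 \<ge> 0"
    "\<And>n. n \<ge> 3 \<Longrightarrow> \<Phi> n wbar - opt_val \<le> C1 * sqrt (\<Phi> n 0 - \<Phi> n wbar) + (\<Sum>i\<in>V4. gap n wbar i)"
    using cycle_gap_bound by blast
  obtain C2 where C2: "C2 \<ge> 0"
    "\<And>n i. n \<ge> 3 \<Longrightarrow> i \<in> V4 \<Longrightarrow> gap n 0 i \<le> C2 * sqrt (\<Phi> n 0 - \<Phi> (Suc n) 0)"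
    using minorant_gap_bound by blast
  \<comment> \<open>The summand 1 only serves to make the constant of the recurrence positive.\<close>
  define C where "C = C1 + real (card V4) * C2 + 1"
  have C: "C > 0" using C1(1) C2(1) by (simp add: C_def add_nonneg_pos)
  define a where "a n = \<Phi> n 0 - opt_val" for n
  have "(a (n + 2))\<^sup>2 \<le> C\<^sup>2 * (a n - a (n + 2))" if n: "n \<ge> 3" for n
  proof -
    have mono: "a (n + 2) \<le> a (n + 1)" "a (n + 1) \<le> a n"
      using \<Phi>_antimono_cycle[of n] \<Phi>_antimono_cycle[of "n + 1"] n by (simp_all add: a_def)
    define r where "r = sqrt (a n - a (n + 2))"
    have r: "r \<ge> 0" using mono by (simp add: r_def)
    have "(\<Sum>i\<in>V4. gap n wbar i) = (\<Sum>i\<in>V4. gap (Suc n) 0 i)"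
      using gap_next_cycle[of n] n by (intro sum.cong) auto
    also have "\<dots> \<le> (\<Sum>i\<in>V4. C2 * r)"
    proof (intro sum_mono)
      fix i assume "i \<in> V4"
      hence "gap (Suc n) 0 i \<le> C2 * sqrt (\<Phi> (Suc n) 0 - \<Phi> (Suc (Suc n)) 0)" using C2(2)[of "Suc n" i] n by simp
      also have "\<dots> \<le> C2 * r"
        using C2(1) mono by (intro mult_left_mono) (auto simp: r_def a_def)
      finally show "gap (Suc n) 0 i \<le> C2 * r" .
    qed
    finally have "(\<Sum>i\<in>V4. gap n wbar i) \<le> real (card V4) * C2 * r" by simp
    moreover have "C1 * sqrt (\<Phi> n 0 - \<Phi> n wbar) \<le> C1 * r"
      using C1(1) mono \<Phi>_next_cycle[of n] n by (intro mult_left_mono) (auto simp: r_def a_def)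
    moreover have "a (n + 1) = \<Phi> n wbar - opt_val" using \<Phi>_next_cycle[of n] n by (simp add: a_def)
    ultimately have "a (n + 1) \<le> C1 * r + real (card V4) * C2 * r" using C1(2)[OF n] by linarith
    also have "\<dots> \<le> C * r" using r by (simp add: C_def algebra_simps)
    finally have "a (n + 2) \<le> C * r" using mono by simp
    moreover have "0 \<le> a (n + 2)" using opt_val_le[of "n + 2" 0] by (simp add: a_def)
    ultimately have "(a (n + 2))\<^sup>2 \<le> (C * r)\<^sup>2" by (rule power_mono)
    also have "\<dots> = C\<^sup>2 * (a n - a (n + 2))" using mono by (simp add: power_mult_distrib r_def)
    finally show ?thesis .
  qed
  from sublinear_rate[where a = a and K = "C\<^sup>2" and N = 3, OF _ this] C show ?thesis unfolding a_def by simp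
qed

end

section \<open>The rate of convergence\<close>

theorem theorem4p6:
  fixes E :: "'v::finite set set"
    and V1 V2 V3 V4 :: "'v set"
    and f :: "'v \<Rightarrow> real^'m::finite \<Rightarrow> ereal"
    and xbar :: "real^'m^'v"
    and \<sigma> Creg :: real and wbar :: nat
    and Eb :: "nat \<Rightarrow> ('v set \<times> 'm) set"
    and S :: "nat \<Rightarrow> nat \<Rightarrow> ('v, 'm) idx set"
    and fm :: "nat \<Rightarrow> nat \<Rightarrow> 'v \<Rightarrow> real^'m \<Rightarrow> real"
    and z :: "nat \<Rightarrow> nat \<Rightarrow> ('v, 'm) idx \<Rightarrow> real^'m^'v"
    and zstar :: "('v, 'm) idx \<Rightarrow> real^'m^'v"
    and h :: "nat \<Rightarrow> ereal"
  assumes graph: "connected_graph E"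
    and partition: "V1 \<union> V2 \<union> V3 \<union> V4 = UNIV"
      "V1 \<inter> V2 = {}" "V1 \<inter> V3 = {}" "V1 \<inter> V4 = {}" "V2 \<inter> V3 = {}" "V2 \<inter> V4 = {}" "V3 \<inter> V4 = {}"
    and f: "\<forall>i. closed_convex_fun (f i)"
    and f_V2: "\<forall>i\<in>V2. \<exists>C. closed C \<and> convex C \<and> f i = conv_indicator C"
    and f_V3: "\<forall>i\<in>V3. \<forall>x. f i x < \<infinity>"
    and f_V4: "\<forall>i\<in>V4. \<forall>x. f i x < \<infinity>"
    and strong: "\<sigma> > 0" "\<forall>i\<in>V4. strongly_convex \<sigma> (fenchel_conj (f i))"
    and Creg: "regularity_constant E TYPE('m) Creg"
    and wbar: "wbar > 0"
    and feasible: "primal_feasible E f xbar"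
    and algorithm: "distributed_dykstra E f V4 xbar Creg wbar Eb S fm z"
    and Eb: "\<forall>n\<ge>1. Eb n = {a \<in> Ebar E. Inr a \<in> (\<Union>w\<in>{1..wbar}. S n w)}"
    and cover: "\<forall>n\<ge>1. range Inl \<subseteq> (\<Union>w\<in>{1..wbar}. S n w)"
    and A1: "assumption_A1 E V4 xbar wbar S fm z"
    and A2: "assumption_A2 V4 wbar S"
    and A3: "assumption_A3 V4 S"
    and zstar: "is_arg_min (dual_obj E f xbar) (\<lambda>_. True) zstar"
    and bounded_iterates:
      "\<forall>\<alpha> \<in> UNIV <+> Ebar E. bounded {z n w \<alpha> | n w. n \<ge> 1 \<and> w \<le> wbar}"
    and h: "\<forall>n\<ge>1. h n = dual_obj E (cur_fun V4 f (fm n 0)) xbar (z n 0) - dual_obj E f xbar zstar"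
  shows "h \<longlonglongrightarrow> 0 \<and>
    (\<exists>g :: nat \<Rightarrow> real. (\<forall>\<^sub>F n in sequentially. h n = ereal (g n)) \<and> g \<in> O(\<lambda>n. 1 / real n))"
proof -
  interpret bounded_dykstra_run E V4 f xbar Creg wbar Eb S fm z zstar
  proof
    show "closed_convex_fun (f i)" for i using f by blast
    show "f i y < \<infinity>" if "i \<in> V4" for i y using f_V4 that by blast
    show "Eb n = {a \<in> Ebar E. Inr a \<in> (\<Union>w\<in>{1..wbar}. S n w)}" if "n \<ge> 1" for n
      using Eb that by blast
    show "range Inl \<subseteq> (\<Union>w\<in>{1..wbar}. S n w)" if "n \<ge> 1" for n
      using cover that by blast
    show "bounded {z n w \<alpha> | n w. n \<ge> 1 \<and> w \<le> wbar}" if "\<alpha> \<in> UNIV <+> Ebar E" for \<alpha>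
      using bounded_iterates that by blast
  qed (fact wbar feasible algorithm A3 Creg zstar)+
  obtain A where A: "\<And>n. n \<ge> 3 \<Longrightarrow> \<Phi> n 0 - opt_val \<le> A / real n"
    using sublinear_convergence by blast
  define g where "g n = \<Phi> n 0 - opt_val" for n
  have h_eq: "\<forall>\<^sub>F n in sequentially. h n = ereal (g n)"
    using eventually_ge_at_top[of 2]
  proof eventually_elim
    case (elim n)
    thus ?case using h dual_obj_cur[of n 0] dual_obj_zstar by (simp add: g_def)
  qed
  have bounds: "\<forall>\<^sub>F n in sequentially. 0 \<le> g n \<and> g n \<le> A / real n"
    using eventually_ge_at_top[of 3]
  proof eventually_elim
    case (elim n)
    thus ?case using A opt_val_le[of n 0] by (simp add: g_def)
  qed
  have "g \<longlonglongrightarrow> 0"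
    by (rule tendsto_sandwich[OF _ _ tendsto_const lim_const_over_n[of A]])
      (use bounds in \<open>auto elim: eventually_mono\<close>)
  hence "(\<lambda>n. ereal (g n)) \<longlonglongrightarrow> 0" by (simp add: zero_ereal_def)
  hence "h \<longlonglongrightarrow> 0" using h_eq by (simp cong: tendsto_cong)
  moreover have "g \<in> O(\<lambda>n. 1 / real n)"
    by (rule bigoI[where c = A]) (use bounds in \<open>auto elim: eventually_mono\<close>)
  ultimately show ?thesis using h_eq by blast
qed

end
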